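(* For $n\ge 1$ let $\mathcal{S}_n=\{A+A : A\subseteq \mathbb{F}_2^n\}$ be the family of all sumsets in $\mathbb{F}_2^n$, where $A+A=\{a+b : a,b\in A\}$. Then $$|\mathcal{S}_n| = (1+o(1))\,(2^n-1)\,2^{2^{n-1}},$$ i.e. $|\mathcal{S}_n|/\big((2^n-1)2^{2^{n-1}}\big)\to 1$ as $n\to\infty$.
   Context: $\mathbb{F}_2^n$ is the $n$-dimensional vector space over the two-element field. In a sumset $A+A$ the sums $a+a$ (which equal $0$) are included, so $A+A=\{a+b: a,b\in A\}$ with $a=b$ allowed. *)

theory Defs
  imports Complex_Main "HOL-Library.Z2" "Jordan_Normal_Form.Matrix"
begin

definition sumset :: "bit vec set \<Rightarrow> bit vec set" where
  "sumset A = {a + b | a b. a \<in> A \<and> b \<in> A}"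

(* carrier_vec n over the two-element field bit is F_2^n. *)
definition sumsets :: "nat \<Rightarrow> bit vec set set" where
  "sumsets n = {sumset A | A. A \<subseteq> carrier_vec n}"

end

theory Submission
  imports Defs "HOL-Library.Function_Algebras" "HOL-Library.Indicator_Function"
begin

text \<open>
  Write \<open>N = 2 ^ n\<close>. For a hyperplane \<open>V\<close> and almost every subset \<open>T\<close> of its complement one has
  \<open>T + T = V\<close>, and then \<open>V \<union> T\<close> is a sumset, namely that of \<open>(x + T) \<union> {x}\<close> for any \<open>x\<close>. This gives
  the lower bound, since few sets contain two hyperplanes.

  For the upper bound, a Fourier argument attaches to \<open>A\<close> a set \<open>C\<close>, a union of cosets of a
  subspace of bounded codimension, such that \<open>C\<close> contains almost all of \<open>A\<close> and \<open>A + A\<close> contains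
  almost all sums that are popular in \<open>C\<close>. There are only polynomially (in \<open>N\<close>) many such \<open>C\<close>. If \<open>C\<close>
  has noticeably fewer than \<open>N/2\<close> elements there are few choices for \<open>A\<close>; if it has noticeably more
  than \<open>N/2\<close> popular sums there are few choices for \<open>A + A\<close>. Otherwise \<open>C\<close>, hence \<open>A\<close>, lies almost
  entirely in a coset of a hyperplane \<open>V\<close>. Then either \<open>A + A\<close> contains \<open>V\<close>, or \<open>A\<close> misses some
  difference \<open>v \<in> V\<close>, which leaves only about \<open>3 ^ (N/4)\<close> choices for the part of \<open>A\<close> in the coset.
\<close>

section \<open>Counting subsets\<close>

text \<open>For nonzero \<open>v\<close> the set \<open>W\<close> splits into pairs
  \<open>{x, x + v}\<close>, and \<open>F\<close> contains at most one point of each: three options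
  for each of \<open>card W / 2\<close> pairs. Squaring avoids halving the exponent.\<close>

lemma card_subsets_avoiding_difference:
  fixes W :: "'a::ab_group_add set"
  assumes "\<And>x. (x::'a) + x = 0" "finite W" "\<And>x. x \<in> W \<Longrightarrow> x + v \<in> W"
  shows "(card {F. F \<subseteq> W \<and> (\<forall>x\<in>F. x + v \<notin> F)})\<^sup>2 \<le> 3 ^ card W"
  using assms(2,3)
proof (induction "card W" arbitrary: W rule: less_induct)
  case less
  define fr where "fr W = {F. F \<subseteq> W \<and> (\<forall>x\<in>F. x + v \<notin> F)}" for W
  have vv: "x + v + v = x" for x
    using assms(1)[of v] by (simp add: add.assoc)
  show ?case
  proof (cases "W = {}")
    case True
    then have "{F. F \<subseteq> W \<and> (\<forall>x\<in>F. x + v \<notin> F)} = {{}}" by auto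
    then show ?thesis by simp
  next
    case nonempty: False
    show ?thesis
    proof (cases "v = 0")
      case True
      then have "{F. F \<subseteq> W \<and> (\<forall>x\<in>F. x + v \<notin> F)} = {{}}" by auto
      then show ?thesis by simp
    next
      case False
      obtain x where x: "x \<in> W" using nonempty by blast
      define W' where "W' = W - {x, x + v}"
      have xv: "x \<noteq> x + v" "x + v \<in> W" using False x less by auto
      then have "card W = card W' + card {x, x + v}"
        using x less(2) unfolding W'_def
        by (metis card_Diff_subset card_mono empty_subsetI finite.emptyI finite_insert insert_subset le_add_diff_inverse2)
      then have cW: "card W = card W' + 2" using xv by simp
      have "finite W'" using less(2) by (simp add: W'_def)
      moreover have "y + v \<in> W'" if "y \<in> W'" for y
        using that less(3)[of y] vv by (auto simp: W'_def)
      ultimately have IH: "(card (fr W'))\<^sup>2 \<le> 3 ^ card W'"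
        unfolding fr_def using less(1)[of W'] cW by simp
      have fin: "finite (fr W')"
        using \<open>finite W'\<close> by (simp add: fr_def)
      have "fr W \<subseteq> (\<lambda>(F, E). F \<union> E) ` (fr W' \<times> {{}, {x}, {x + v}})"
      proof
        fix F assume F: "F \<in> fr W"
        then have "F \<inter> {x, x + v} \<in> {{}, {x}, {x + v}}"
          unfolding fr_def by auto
        moreover have "F - {x, x + v} \<in> fr W'"
          using F unfolding fr_def W'_def by auto
        moreover have "F = (F - {x, x + v}) \<union> (F \<inter> {x, x + v})" by auto
        ultimately show "F \<in> (\<lambda>(F, E). F \<union> E) ` (fr W' \<times> {{}, {x}, {x + v}})"
          by (intro image_eqI[where x = "(F - {x, x + v}, F \<inter> {x, x + v})"]) auto
      qed
      then have "card (fr W) \<le> card (fr W' \<times> {{}, {x}, {x + v}})"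
        using fin by (intro surj_card_le) auto
      also have "\<dots> \<le> card (fr W') * 3"
        by (simp add: card_cartesian_product card_insert_if)
      finally have "(card (fr W))\<^sup>2 \<le> (card (fr W') * 3)\<^sup>2"
        by (rule power_mono) simp
      also have "\<dots> \<le> 3 ^ card W' * 9"
        using IH by (simp add: power_mult_distrib)
      also have "\<dots> = 3 ^ card W" by (simp add: cW)
      finally show ?thesis by (simp add: fr_def)
    qed
  qed
qed

text \<open>Markov's inequality for the generating function \<^term>\<open>(1 + x) ^ card X\<close> of the subsets of \<^term>\<open>X\<close>.\<close>

lemma card_small_subsets_le:
  fixes d :: real
  assumes "d > 0"
  shows "\<exists>e>0. \<forall>X :: 'a set. finite X \<longrightarrow>
    real (card {E. E \<subseteq> X \<and> real (card E) \<le> e * real (card X)}) \<le> 2 powr (d * real (card X))"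
proof -
  define x where "x = 2 powr (d/2) - (1::real)"
  have "(2::real) powr 0 < 2 powr (d/2)"
    using assms by (intro powr_less_mono) auto
  then have x: "x > 0" by (simp add: x_def)
  \<comment> \<open>The cap \<open>1/2\<close> keeps \<open>y\<close> below 1, so that
    \<open>log 2 (1/y)\<close> is positive and smaller sets get larger weight
    \<open>y ^ card E\<close>.\<close>
  define y where "y = min x (1/2)"
  have y: "y > 0" "y < 1" "1 + y \<le> 2 powr (d/2)"
    using x by (auto simp: y_def x_def)
  \<comment> \<open>Chosen so that the Markov factor \<open>y powr (-(e * m))\<close> costs
    \<open>2 powr (d/2 * m)\<close>; the other half of \<open>d\<close> pays for
    \<open>(1 + y) ^ card X\<close>.\<close>
  define e where "e = d/2 / log 2 (1/y)"
  have lg: "log 2 (1/y) > 0" using y by simp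
  have e: "e > 0" using lg assms by (simp add: e_def)
  have ye: "y powr (-(e * m)) = 2 powr (d/2 * m)" for m
  proof -
    have "y = 2 powr (- log 2 (1/y))"
      using y by (simp add: powr_minus log_divide)
    then have "y powr (-(e * m)) = 2 powr (log 2 (1/y) * (e * m))"
      by (metis minus_mult_minus powr_powr)
    also have "log 2 (1/y) * (e * m) = d/2 * m"
      using lg by (simp add: e_def)
    finally show ?thesis .
  qed
  have "real (card {E. E \<subseteq> X \<and> real (card E) \<le> e * real (card X)}) \<le> 2 powr (d * card X)" if X: "finite X" for X :: "'a set"
  proof -
    define m where "m = real (card X)"
    define S where "S = {E. E \<subseteq> X \<and> card E \<le> e * m}"
    have "real (card S) * y powr (e * m) \<le> (\<Sum>E\<in>S. y ^ card E)"
    proof (rule sum_bounded_below)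
      fix E assume "E \<in> S"
      then have "y powr (e * m) \<le> y powr (card E)"
        using y by (intro powr_mono') (auto simp: S_def)
      then show "y powr (e * m) \<le> y ^ card E"
        using y by (simp add: powr_realpow)
    qed
    also have "\<dots> \<le> (\<Sum>E\<in>Pow X. y ^ card E)"
      using X y by (intro sum_mono2) (auto simp: S_def)
    also have "\<dots> = (\<Sum>E\<in>Pow X. (\<Prod>a\<in>E. y) * (\<Prod>a\<in>X - E. 1))"
      by simp
    also have "\<dots> = (\<Prod>a\<in>X. y + 1)"
      using X by (rule prod_add[symmetric])
    also have "\<dots> = (1 + y) ^ card X" by (simp add: add.commute)
    also have "\<dots> \<le> (2 powr (d/2)) ^ card X"
      using y by (intro power_mono) auto
    also have "\<dots> = (2 powr (d/2)) powr m"
      unfolding m_def by (rule powr_realpow[symmetric]) simp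
    also have "\<dots> = 2 powr (d/2 * m)"
      by (rule powr_powr)
    finally have "real (card S) * y powr (e * m) * y powr (-(e * m)) \<le> 2 powr (d/2 * m) * 2 powr (d/2 * m)"
      unfolding ye by (intro mult_right_mono) auto
    also have "real (card S) * y powr (e * m) * y powr (-(e * m)) = real (card S)"
      using y by (simp add: powr_minus)
    also have "2 powr (d/2 * m) * 2 powr (d/2 * m) = 2 powr (d * m)"
      by (simp add: powr_add[symmetric])
    finally show ?thesis by (simp add: S_def m_def)
  qed
  with e show ?thesis by blast
qed

lemma card_image_Sigma_le:
  fixes M :: real
  assumes "finite X" "\<And>x. x \<in> X \<Longrightarrow> finite (Y x)" "\<And>x. x \<in> X \<Longrightarrow> card (Y x) \<le> M"
  shows "card (f ` Sigma X Y) \<le> card X * M"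
proof -
  have "card (f ` Sigma X Y) \<le> card (Sigma X Y)"
    using assms by (intro card_image_le) auto
  also have "\<dots> = (\<Sum>x\<in>X. card (Y x))"
    using assms by (intro card_SigmaI) auto
  finally have "real (card (f ` Sigma X Y)) \<le> (\<Sum>x\<in>X. real (card (Y x)))"
    by (simp flip: of_nat_sum)
  also have "\<dots> \<le> card X * M"
    using assms(3) by (intro sum_bounded_above)
  finally show ?thesis .
qed

text \<open>Fourth powers: \<open>81 \<le> 128\<close>. This turns \<open>3 ^ (N/4)\<close> into at
  most \<open>2 powr (7/16 * N)\<close>, well below \<open>2 powr (N/2)\<close>.\<close>

lemma three_le_two_powr: "3 \<le> 2 powr (7/4 :: real)"
proof (rule power_le_imp_le_base)
  show "3 ^ Suc 3 \<le> (2 powr (7/4 :: real)) ^ Suc 3"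
    by (simp add: powr_power)
qed simp

section \<open>Fourier analysis on elementary abelian 2-groups\<close>

text \<open>Repeats \<open>sumset\<close> over any type with addition: the argument runs in a type
  that is a group, whereas \<open>bit vec\<close> contains vectors of all dimensions.\<close>

definition self_sum :: "'a::plus set \<Rightarrow> 'a set" where
  "self_sum A = {a + b | a b. a \<in> A \<and> b \<in> A}"

text \<open>The pairing \<open>chi\<close> identifies the group with its dual, so Fourier transforms
  are again functions on \<open>G\<close>, and hyperplanes are the kernels of \<open>chi c\<close>
  for nonzero \<open>c\<close>.\<close>

locale elementary_2_group =
  fixes G :: "'a::ab_group_add set" and chi :: "'a \<Rightarrow> 'a \<Rightarrow> real"
  assumes finite_G: "finite G"
    and zero_G [simp]: "0 \<in> G"
    and add_G [simp]: "x \<in> G \<Longrightarrow> y \<in> G \<Longrightarrow> x + y \<in> G"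
    and add_self [simp]: "(x::'a) + x = 0"
    and chi_values: "chi c x = 1 \<or> chi c x = -1"
    and chi_add: "chi c (x + y) = chi c x * chi c y"
    and chi_commute: "chi c x = chi x c"
    and chi_nondegenerate: "c \<in> G \<Longrightarrow> c \<noteq> 0 \<Longrightarrow> \<exists>x\<in>G. chi c x = -1"
begin

abbreviation "N \<equiv> real (card G)"

lemma add_self_left [simp]: "x + (x + y) = (y::'a)"
  by (simp flip: add.assoc)

lemma add_eq_0_iff_eq: "x + y = 0 \<longleftrightarrow> x = (y::'a)"
  by (metis add_self add_self_left add.right_neutral)

lemma N_pos: "N > 0"
  using finite_G zero_G by (metis card_gt_0_iff empty_iff of_nat_0_less_iff)

lemma chi_zero [simp]: "chi c 0 = 1" "chi 0 c = 1"
proof -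
  show *: "chi c 0 = 1"
    using chi_add[of c 0 0] chi_values[of c 0] by auto
  then show "chi 0 c = 1"
    by (simp add: chi_commute[of 0 c])
qed

lemma chi_mult_self [simp]: "chi c x * chi c x = 1"
  using chi_values[of c x] by auto

lemma abs_chi [simp]: "\<bar>chi c x\<bar> = 1"
  using chi_values[of c x] by auto

lemma chi_add_left: "chi (c + d) x = chi c x * chi d x"
  by (metis chi_add chi_commute)

lemma sum_shift:
  assumes "y \<in> G"
  shows "(\<Sum>x\<in>G. f (x + y)) = (\<Sum>x\<in>G. f x)"
  by (rule sum.reindex_bij_witness[where i = "\<lambda>x. x + y" and j = "\<lambda>x. x + y"])
     (use assms in \<open>auto simp: add.assoc\<close>)

text \<open>Translation by \<open>y\<close> multiplies the sum by \<open>f y\<close>, which is not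
  1. A general \<open>f\<close> covers the product of a character with another sign function, which
  occurs later.\<close>

lemma sum_multiplicative_eq_0:
  fixes f :: "'a \<Rightarrow> real"
  assumes mult: "\<And>x y. x \<in> G \<Longrightarrow> y \<in> G \<Longrightarrow> f (x + y) = f x * f y"
    and "y \<in> G" "f y \<noteq> 1"
  shows "(\<Sum>x\<in>G. f x) = 0"
proof -
  have "(\<Sum>x\<in>G. f x) = (\<Sum>x\<in>G. f (x + y))"
    by (rule sum_shift[OF \<open>y \<in> G\<close>, symmetric])
  also have "\<dots> = (\<Sum>x\<in>G. f x) * f y"
    using assms by (simp add: sum_distrib_right)
  finally show ?thesis
    using \<open>f y \<noteq> 1\<close> by auto
qed

lemma sum_chi:
  assumes "c \<in> G"
  shows "(\<Sum>x\<in>G. chi c x) = (if c = 0 then N else 0)"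
proof (cases "c = 0")
  case False
  then obtain y where "y \<in> G" "chi c y = -1"
    using chi_nondegenerate assms by blast
  then have "(\<Sum>x\<in>G. chi c x) = 0"
    by (intro sum_multiplicative_eq_0[where y = y]) (auto simp: chi_add)
  with False show ?thesis by simp
qed simp

section \<open>Fourier transform, convolution and representation counts\<close>

definition fourier :: "('a \<Rightarrow> real) \<Rightarrow> 'a \<Rightarrow> real" where
  "fourier f c = (\<Sum>x\<in>G. f x * chi c x)"

text \<open>Here \<open>x + y\<close> is the usual \<open>x - y\<close>, each element being its own
  negative.\<close>

definition conv :: "('a \<Rightarrow> real) \<Rightarrow> ('a \<Rightarrow> real) \<Rightarrow> 'a \<Rightarrow> real" where
  "conv f g x = (\<Sum>y\<in>G. f y * g (x + y))"

text \<open>Expanding the squares and summing over \<open>c\<close> first leaves only the diagonal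
  \<open>x = y\<close>, by orthogonality; the unnormalised transform produces the factor
  \<open>N\<close>.\<close>

lemma parseval: "(\<Sum>c\<in>G. (fourier f c)\<^sup>2) = N * (\<Sum>x\<in>G. (f x)\<^sup>2)"
proof -
  have "(\<Sum>c\<in>G. (fourier f c)\<^sup>2) = (\<Sum>c\<in>G. \<Sum>x\<in>G. \<Sum>y\<in>G. f x * f y * chi (x + y) c)"
    unfolding fourier_def power2_eq_square sum_product
    by (intro sum.cong refl) (simp only: chi_commute chi_add mult_ac)
  also have "\<dots> = (\<Sum>x\<in>G. \<Sum>c\<in>G. \<Sum>y\<in>G. f x * f y * chi (x + y) c)"
    by (rule sum.swap)
  also have "\<dots> = (\<Sum>x\<in>G. \<Sum>y\<in>G. f x * f y * (\<Sum>c\<in>G. chi (x + y) c))"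
    by (rule sum.cong[OF refl], simp only: sum_distrib_left, rule sum.swap)
  also have "\<dots> = (\<Sum>x\<in>G. \<Sum>y\<in>G. if x = y then f x * f y * N else 0)"
    by (intro sum.cong refl) (simp add: sum_chi add_eq_0_iff_eq)
  also have "\<dots> = N * (\<Sum>x\<in>G. (f x)\<^sup>2)"
    using finite_G by (simp add: sum_distrib_left power2_eq_square mult_ac)
  finally show ?thesis .
qed

lemma fourier_conv: "fourier (conv f g) c = fourier f c * fourier g c"
proof -
  have "fourier (conv f g) c = (\<Sum>x\<in>G. \<Sum>y\<in>G. f y * (g (x + y) * chi c x))"
    unfolding fourier_def conv_def by (simp add: sum_distrib_right mult.assoc)
  also have "\<dots> = (\<Sum>y\<in>G. f y * (\<Sum>x\<in>G. g (x + y) * chi c x))"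
    by (subst sum.swap) (simp add: sum_distrib_left)
  also have "\<dots> = (\<Sum>y\<in>G. f y * (\<Sum>x\<in>G. g x * chi c (x + y)))"
  proof (intro sum.cong refl)
    fix y assume "y \<in> G"
    then show "f y * (\<Sum>x\<in>G. g (x + y) * chi c x) = f y * (\<Sum>x\<in>G. g x * chi c (x + y))"
      using sum_shift[of y "\<lambda>x. g x * chi c (x + y)"] by (simp add: add.assoc)
  qed
  also have "\<dots> = (\<Sum>y\<in>G. (f y * chi c y) * (\<Sum>x\<in>G. g x * chi c x))"
    by (simp add: chi_add sum_distrib_left mult_ac)
  also have "\<dots> = fourier f c * fourier g c"
    unfolding fourier_def by (rule sum_distrib_right[symmetric])
  finally show ?thesis .
qed

text \<open>The number of ordered pairs in \<open>B\<close> with sum \<open>x\<close>, as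
  \<open>b\<close> determines its partner \<open>x + b\<close>; equally, the number of points of
  \<open>B\<close> that the shift by \<open>x\<close> keeps in \<open>B\<close>.\<close>

definition rep :: "'a set \<Rightarrow> 'a \<Rightarrow> real" where
  "rep B x = real (card {b \<in> B. x + b \<in> B})"

lemma rep_eq_conv:
  assumes "B \<subseteq> G"
  shows "rep B x = conv (indicator B) (indicator B) x"
proof -
  have "conv (indicator B) (indicator B) x = (\<Sum>y\<in>G. if y \<in> {b \<in> B. x + b \<in> B} then 1 else 0)"
    unfolding conv_def by (intro sum.cong refl) (simp add: indicator_def)
  also have "\<dots> = real (card (G \<inter> {b \<in> B. x + b \<in> B}))"
    using finite_G by (simp only: sum.inter_restrict[symmetric]) simp
  also have "G \<inter> {b \<in> B. x + b \<in> B} = {b \<in> B. x + b \<in> B}"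
    using assms by auto
  finally show ?thesis by (simp add: rep_def)
qed

lemma finite_subset_G: "B \<subseteq> G \<Longrightarrow> finite B"
  using finite_G finite_subset by blast

lemma rep_le: "B \<subseteq> G \<Longrightarrow> rep B x \<le> card B"
  unfolding rep_def by (simp add: card_mono finite_subset_G)

lemma sum_rep:
  assumes "B \<subseteq> G" "U \<subseteq> G"
  shows "(\<Sum>x\<in>U. rep B x) = (\<Sum>a\<in>B. real (card {b \<in> B. a + b \<in> U}))"
proof -
  have "(\<Sum>x\<in>U. card {b \<in> B. x + b \<in> B}) = card (SIGMA x:U. {b \<in> B. x + b \<in> B})"
    using assms by (subst card_SigmaI) (auto simp: finite_subset_G)
  also have "\<dots> = card (SIGMA a:B. {b \<in> B. a + b \<in> U})"
    by (rule bij_betw_same_card[of "\<lambda>(x, b). (x + b, b)"], rule bij_betwI[where g = "\<lambda>(a, b). (a + b, b)"])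
       (auto simp: add.assoc)
  also have "\<dots> = (\<Sum>a\<in>B. card {b \<in> B. a + b \<in> U})"
    using assms by (subst card_SigmaI) (auto simp: finite_subset_G)
  finally show ?thesis
    unfolding rep_def of_nat_sum[symmetric] by simp
qed

text \<open>If \<open>x + b\<close> and \<open>y + b\<close> both lie in \<open>B\<close>, then
  \<open>y + b\<close> is counted by \<open>rep B (x + y)\<close>; inclusion-exclusion in
  \<open>B\<close> gives many such \<open>b\<close>. Thus almost-periods add, and so do their
  errors.\<close>

lemma rep_add:
  assumes "B \<subseteq> G"
  shows "rep B x + rep B y - card B \<le> rep B (x + y)"
proof -
  define R where "R z = {b \<in> B. z + b \<in> B}" for z
  have fR: "finite (R z)" for z
    using finite_subset_G[OF assms] by (simp add: R_def)
  have "card (R x \<union> R y) \<le> card B"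
    by (rule card_mono) (auto simp: R_def finite_subset_G assms)
  then have "card (R x) + card (R y) \<le> card B + card (R x \<inter> R y)"
    using card_Un_Int[OF fR fR, of x y] by linarith
  moreover have "card (R x \<inter> R y) \<le> card (R (x + y))"
    by (rule card_inj_on_le[where f = "\<lambda>b. y + b"]) (auto simp: inj_on_def R_def add.assoc finite_subset_G assms)
  ultimately show ?thesis
    unfolding rep_def R_def[symmetric] by linarith
qed

section \<open>Popular sums and containers\<close>

lemma card_halfspace:
  assumes "c \<in> G" "c \<noteq> 0" "s = 1 \<or> s = -1"
  shows "2 * card {x \<in> G. chi c x = s} = card G"
proof -
  define P M where "P = {x \<in> G. chi c x = 1}" and "M = {x \<in> G. chi c x = -1}"
  have G: "G = P \<union> M" "P \<inter> M = {}" "finite P" "finite M"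
    using chi_values finite_G by (auto simp: P_def M_def)
  have "(\<Sum>x\<in>G. chi c x) = (\<Sum>x\<in>P. chi c x) + (\<Sum>x\<in>M. chi c x)"
    using G by (metis sum.union_disjoint)
  also have "\<dots> = real (card P) - real (card M)"
    by (simp add: P_def M_def)
  finally have "card P = card M"
    using assms by (simp add: sum_chi)
  moreover have "card G = card P + card M"
    using G by (metis card_Un_disjoint)
  ultimately show ?thesis
    using assms(3) by (auto simp: P_def M_def)
qed

lemma card_translate [simp]: "card ((+) y ` X) = card (X :: 'a set)"
  by (rule card_image) (simp add: inj_on_def)

text \<open>The size bounds force index two, so the function that is 1 on \<open>U\<close> and -1
  off it is multiplicative. By Parseval it has a nonzero Fourier coefficient, and the corresponding
  character must equal it.\<close>

lemma index_2_subgroup: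
  assumes U: "U \<subseteq> G" "0 \<in> U" "\<And>x y. x \<in> U \<Longrightarrow> y \<in> U \<Longrightarrow> x + y \<in> U"
    and card: "card U < card G" "card G < 3 * card U"
  obtains c where "c \<in> G" "c \<noteq> 0" "U = {x \<in> G. chi c x = 1}"
proof -
  have coset: "x + y \<in> U" if "x \<in> G" "y \<in> G" "x \<notin> U" "y \<notin> U" for x y
  proof (rule ccontr)
    assume xy: "x + y \<notin> U"
    have *: "z \<in> U" if "z + u = v" "u \<in> U" "v \<in> U" for z u v
      using that U(3)[of v u] by (auto simp: add.assoc)
    have "U \<inter> (+) x ` U = {}" "U \<inter> (+) y ` U = {}"
      using * that by blast+
    moreover have "(+) x ` U \<inter> (+) y ` U = {}"
    proof -
      have False if "u \<in> U" "v \<in> U" "x + u = y + v" for u v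
      proof -
        have "x + y = u + v"
          using that(3) by (metis add.assoc add.commute add_self_left)
        then show False using xy U(3) that by simp
      qed
      then show ?thesis by blast
    qed
    \<comment> \<open>Three disjoint translates of \<open>U\<close> would not fit into
      \<open>G\<close>.\<close>
    ultimately have "card (U \<union> (+) x ` U \<union> (+) y ` U) = 3 * card U"
      using finite_subset_G[OF U(1)] by (simp add: card_Un_disjoint Int_Un_distrib2)
    moreover have "U \<union> (+) x ` U \<union> (+) y ` U \<subseteq> G"
      using U(1) that by auto
    ultimately show False
      using card_mono[OF finite_G] card(2) by (metis not_less)
  qed
  define f :: "'a \<Rightarrow> real" where "f x = (if x \<in> U then 1 else -1)" for x
  have f_add: "f (x + y) = f x * f y" if "x \<in> G" "y \<in> G" for x y
  proof -
    have *: "x + y \<notin> U" if "x \<in> U" "y \<notin> U" for x y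
      using U(3)[of x "x + y"] that by auto
    then have "x + y \<notin> U" if "x \<notin> U" "y \<in> U"
      using that by (simp add: add.commute[of x])
    then show ?thesis
      using U(3) coset that * by (auto simp: f_def)
  qed
  have "(\<Sum>c\<in>G. (fourier f c)\<^sup>2) = N * N"
    by (simp add: parseval f_def if_distrib[of "\<lambda>z. z\<^sup>2"] cong: if_cong)
  then obtain c where c: "c \<in> G" "fourier f c \<noteq> 0"
    using N_pos by (metis (no_types, lifting) mult_eq_0_iff order_less_irrefl sum.neutral power_zero_numeral)
  have eq: "f x * chi c x = 1" if "x \<in> G" for x
  proof (rule ccontr)
    assume "f x * chi c x \<noteq> 1"
    then have "(\<Sum>x\<in>G. f x * chi c x) = 0"
      using that by (intro sum_multiplicative_eq_0[where y = x]) (auto simp: f_add chi_add)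
    then show False using c by (simp add: fourier_def)
  qed
  have Ueq: "U = {x \<in> G. chi c x = 1}"
    using eq U(1) by (force simp: f_def split: if_splits)
  moreover have "c \<noteq> 0"
    using Ueq card(1) by auto
  ultimately show ?thesis using that c(1) by blast
qed

definition popular :: "real \<Rightarrow> 'a set \<Rightarrow> 'a set" where
  "popular k B = {x \<in> G. rep B x \<ge> k * N}"

text \<open>Most of the mass of \<^term>\<open>rep B\<close> sits on few popular sums, so \<^term>\<open>B\<close> is almost invariant
  under most of them; the almost-periods generate a subgroup still consisting of popular sums.\<close>

lemma near_hyperplane:
  assumes B: "B \<subseteq> G" and th: "0 < t" "t \<le> 1/10"
    and large: "(1/2 - t\<^sup>2/10) * N < card B"
    and few: "card (popular (t\<^sup>2/10) B) < (1/2 + t\<^sup>2/10) * N"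
  obtains c s where "c \<in> G" "c \<noteq> 0" "s = 1 \<or> s = -1" "card (B - {x. chi c x = s}) \<le> 2 * t * N"
proof -
  \<comment> \<open>Since \<open>t \<le> 1/10\<close>, this gives \<open>k \<le> t/100\<close>, so
    errors of order \<open>k * N\<close> are negligible against \<open>t * N\<close>.\<close>
  define k where "k = t\<^sup>2/10"
  define P where "P = popular k B"
  define b p where "b = real (card B)" and "p = real (card P)"
  \<comment> \<open>The almost-periods: shifts that keep a proportion of at least
    \<open>1 - t\<close> of \<open>B\<close> inside \<open>B\<close>.\<close>
  define Q where "Q = {x \<in> G. rep B x \<ge> (1 - t) * b}"
  define q where "q = real (card Q)"
  have "t * t \<le> t * (1/10)"
    using th by (intro mult_left_mono) auto
  then have k: "0 < k" "k \<le> t/100" "k \<le> 1/1000"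
    unfolding k_def power2_eq_square using th by (simp, linarith+)
  have kN: "k * N \<le> N / 1000"
    using k N_pos by (simp add: field_simps)
  have b: "b > N/2 - k * N" and p: "p < N/2 + k * N"
    using large few by (simp_all add: k_def b_def p_def P_def algebra_simps)
  then have Nb: "N \<le> (201/100) * b" and b_pos: "b > 0"
    using kN N_pos by linarith+
  have PG: "P \<subseteq> G" and QG: "Q \<subseteq> G"
    by (auto simp: P_def popular_def Q_def)
  note fins = finite_subset_G[OF PG] finite_subset_G[OF QG] finite_subset_G[OF B]
  \<comment> \<open>Errors up to \<open>5 * t\<close> will accumulate: two from each of two elements
    of \<open>U\<close> and one more from \<open>Q\<close>. As \<open>5 * t \<le> 1/2\<close>, such
    shifts are still popular.\<close>
  have pop: "x \<in> P" if "x \<in> G" "rep B x \<ge> (1 - r * t) * b" "r \<le> 5" for x r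
  proof -
    have "r * t \<le> 5 * (1/10)"
      using mult_right_mono[OF \<open>r \<le> 5\<close>, of t] th by linarith
    then have "(1/2) * b \<le> (1 - r * t) * b"
      using b_pos by (intro mult_right_mono) auto
    then have "k * N \<le> rep B x"
      using that kN Nb N_pos by linarith
    then show ?thesis
      using that by (simp add: P_def popular_def)
  qed
  have QP: "Q \<subseteq> P"
    using pop[where r = 1] by (auto simp: Q_def)
  then have qp: "q \<le> p"
    using card_mono[OF fins(1)] by (simp add: p_def q_def)
  \<comment> \<open>All pairs from \<open>B\<close> are counted, then split by their sum into
    \<open>Q\<close>, \<open>P - Q\<close> and \<open>G - P\<close>, where \<open>rep B\<close> is
    at most \<open>b\<close>, \<open>(1 - t) * b\<close> and \<open>k * N\<close>.\<close>
  have "b * b = (\<Sum>x\<in>G. rep B x)"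
  proof -
    have "(\<Sum>x\<in>G. rep B x) = (\<Sum>a\<in>B. real (card {b \<in> B. a + b \<in> G}))"
      using B by (intro sum_rep) auto
    also have "\<dots> = (\<Sum>a\<in>B. b)"
      unfolding b_def using B by (intro sum.cong refl arg_cong[where f = "\<lambda>X. real (card X)"]) (auto simp: subset_iff)
    finally show ?thesis by (simp add: b_def)
  qed
  also have "\<dots> = (\<Sum>x\<in>Q. rep B x) + (\<Sum>x\<in>P - Q. rep B x) + (\<Sum>x\<in>G - P. rep B x)"
    using sum.subset_diff[OF PG finite_G, of "rep B"] sum.subset_diff[OF QP fins(1), of "rep B"] by simp
  also have "\<dots> \<le> q * b + (p - q) * ((1 - t) * b) + N * (k * N)"
  proof (intro add_mono)
    show "(\<Sum>x\<in>Q. rep B x) \<le> q * b"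
      unfolding q_def b_def using rep_le[OF B] by (intro sum_bounded_above) auto
    have "card (P - Q) = p - q"
      using card_Diff_subset[OF fins(2) QP] card_mono[OF fins(1) QP] by (simp add: p_def q_def)
    moreover have "(\<Sum>x\<in>P - Q. rep B x) \<le> card (P - Q) * ((1 - t) * b)"
      using PG by (intro sum_bounded_above) (auto simp: Q_def)
    ultimately show "(\<Sum>x\<in>P - Q. rep B x) \<le> (p - q) * ((1 - t) * b)"
      by simp
    have "(\<Sum>x\<in>G - P. rep B x) \<le> card (G - P) * (k * N)"
      by (intro sum_bounded_above) (auto simp: P_def popular_def)
    also have "\<dots> \<le> N * (k * N)"
      using k N_pos finite_G by (intro mult_right_mono) (auto simp: card_mono)
    finally show "(\<Sum>x\<in>G - P. rep B x) \<le> N * (k * N)" .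
  qed
  also have "N * (k * N) \<le> ((201/100) * b) * (k * N)"
    using Nb k N_pos by (intro mult_right_mono) auto
  finally have "b * b \<le> (q + (p - q) * (1 - t) + (201/100) * (k * N)) * b"
    by (simp add: algebra_simps)
  then have bb: "b \<le> q + (p - q) * (1 - t) + (201/100) * (k * N)"
    using b_pos by (metis mult_right_le_imp_le)
  have "(p - q) * (1 - t) \<le> (p - q) * 1"
    using qp th by (intro mult_left_mono) auto
  then have b_le: "b \<le> p + (201/100) * (k * N)"
    using bb by simp
  have q_large: "q \<ge> (45/100) * N"
  proof -
    \<comment> \<open>Naming the products makes the comparison linear: \<open>t * q\<close> is at
      least \<open>z/2 - 4.01 * x\<close>, and \<open>x \<le> z/100\<close>.\<close>
    define x y z where "x = k * N" and "y = p * t" and "z = t * N"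
    have "p * (1 - t) \<le> (N/2 + x) * (1 - t)"
      using p th by (intro mult_right_mono) (auto simp: x_def)
    then have "p - y \<le> N/2 + x - z/2 - x * t"
      by (simp add: y_def z_def field_simps)
    moreover have "x * t \<ge> 0"
      using k th by (simp add: x_def)
    moreover have "b \<le> p - y + t * q + (201/100) * x"
      using bb by (simp add: x_def y_def field_simps)
    moreover have "b > N/2 - x"
      using b by (simp add: x_def)
    ultimately have "t * q \<ge> z/2 - (401/100) * x"
      by linarith
    moreover have "x \<le> z/100"
      using mult_right_mono[OF k(2), of N] by (simp add: x_def z_def)
    moreover have "z > 0"
      using th N_pos by (simp add: z_def)
    ultimately have "t * q \<ge> (45/100) * z"
      by linarith
    then have "t * q \<ge> t * ((45/100) * N)"
      by (simp add: z_def mult_ac)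
    then show ?thesis using th by simp
  qed
  define U where "U = self_sum Q"
  have UI: "x + y \<in> U" if "x \<in> Q" "y \<in> Q" for x y
    using that by (auto simp: U_def self_sum_def)
  have repU: "rep B x \<ge> (1 - 2 * t) * b" if "x \<in> U" for x
  proof -
    from that obtain y z where yz: "y \<in> Q" "z \<in> Q" "x = y + z"
      by (auto simp: U_def self_sum_def)
    then show ?thesis
      using rep_add[OF B, of y z] by (simp add: Q_def b_def algebra_simps)
  qed
  have UG: "U \<subseteq> G"
    using QG by (auto simp: U_def self_sum_def subset_iff)
  have UP: "U \<subseteq> P"
    using repU UG pop[where r = 2] by auto
  have Q_ne: "Q \<noteq> {}"
    using q_large N_pos by (auto simp: q_def)
  have U0: "0 \<in> U"
    using Q_ne UI by (metis add_self equals0I)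
  \<comment> \<open>The sum \<open>z\<close> is an almost-period with error \<open>4 * t\<close>, so
    both \<open>Q\<close> and its shift by \<open>z\<close> lie in \<open>P\<close>. Each has at
    least \<open>0.45 * N\<close> elements and \<open>P\<close> has fewer than
    \<open>0.501 * N\<close>, so they meet, and \<open>z\<close> is a sum of two elements of
    \<open>Q\<close>.\<close>
  have U_add: "x + y \<in> U" if xy: "x \<in> U" "y \<in> U" for x y
  proof -
    define z where "z = x + y"
    have zG: "z \<in> G" using xy UG by (auto simp: z_def subset_iff)
    have repz: "rep B z \<ge> (1 - 4 * t) * b"
      using rep_add[OF B, of x y] repU[OF xy(1)] repU[OF xy(2)]
      by (simp add: z_def b_def algebra_simps)
    have sub: "(+) z ` Q \<subseteq> P"
    proof clarify
      fix a assume a: "a \<in> Q"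
      then have "rep B (z + a) \<ge> (1 - 5 * t) * b"
        using rep_add[OF B, of z a] repz by (simp add: Q_def b_def algebra_simps)
      moreover have "z + a \<in> G" using zG a QG by (auto simp: subset_iff)
      ultimately show "z + a \<in> P"
        using pop[where r = 5] by auto
    qed
    have "Q \<inter> (+) z ` Q \<noteq> {}"
    proof
      assume "Q \<inter> (+) z ` Q = {}"
      then have "card (Q \<union> (+) z ` Q) = 2 * card Q"
        using fins by (simp add: card_Un_disjoint)
      moreover have "card (Q \<union> (+) z ` Q) \<le> card P"
        using sub QP fins by (intro card_mono) auto
      ultimately have "2 * q \<le> p" by (simp add: p_def q_def)
      then show False using q_large p kN N_pos by simp
    qed
    then obtain a where "a \<in> Q" "z + a \<in> Q" by blast
    then have "(z + a) + a \<in> U" by (rule UI[rotated])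
    then show ?thesis by (simp add: z_def add.assoc)
  qed
  have "card U \<le> card P"
    using UP fins by (intro card_mono)
  then have "real (card U) \<le> p"
    by (simp add: p_def)
  then have lt: "card U < card G"
    using p kN N_pos by linarith
  have "card Q \<le> card U"
  proof -
    obtain a where "a \<in> Q" using Q_ne by blast
    then have "(+) a ` Q \<subseteq> U" using UI by auto
    then show ?thesis
      using card_mono[OF finite_subset_G[OF UG], of "(+) a ` Q"] by simp
  qed
  then have gt: "card G < 3 * card U"
    using q_large N_pos by (simp add: q_def)
  obtain c where c: "c \<in> G" "c \<noteq> 0" and U: "U = {x \<in> G. chi c x = 1}"
    by (rule index_2_subgroup[OF UG U0 U_add lt gt])
  have card_U: "real (card U) = N/2"
    using card_halfspace[OF c, of 1] U by simp
  define m where "m s = card {x \<in> B. chi c x = s}" for s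
  define M where "M = max (m 1) (m (-1))"
  \<comment> \<open>Pairs with sum in \<open>U\<close> lie on the same side of the hyperplane. Each
    of the \<open>N/2\<close> sums in \<open>U\<close> has at least \<open>(1 - 2 * t) * b\<close>
    pairs, and each \<open>a\<close> has at most \<open>M\<close> partners, so the fuller side is
    nearly full.\<close>
  have "N/2 * ((1 - 2 * t) * b) \<le> (\<Sum>x\<in>U. rep B x)"
    using sum_bounded_below[of U "(1 - 2 * t) * b" "rep B"] repU card_U by simp
  also have "\<dots> = (\<Sum>a\<in>B. real (card {b \<in> B. a + b \<in> U}))"
    by (rule sum_rep[OF B UG])
  also have "\<dots> \<le> b * real M"
    unfolding b_def
  proof (rule sum_bounded_above)
    fix a assume a: "a \<in> B"
    have "{b \<in> B. a + b \<in> U} \<subseteq> {b \<in> B. chi c b = chi c a}"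
    proof clarify
      fix b assume "a + b \<in> U"
      then have "chi c a * chi c b = 1" by (simp add: U chi_add)
      then show "chi c b = chi c a"
        using chi_values[of c a] by auto
    qed
    then have "card {b \<in> B. a + b \<in> U} \<le> m (chi c a)"
      unfolding m_def by (intro card_mono) (use fins in auto)
    also have "\<dots> \<le> M"
      using chi_values[of c a] by (auto simp: M_def)
    finally show "real (card {b \<in> B. a + b \<in> U}) \<le> real M" by simp
  qed
  finally have "b * (N/2 * (1 - 2 * t)) \<le> b * real M"
    by (simp add: mult_ac)
  then have "N/2 * (1 - 2 * t) \<le> M"
    using b_pos by (rule mult_left_le_imp_le)
  then have M: "N/2 - t * N \<le> M"
    by (simp add: algebra_simps)
  obtain s where s: "s = 1 \<or> s = -1" "m s = M"
    by (metis M_def max_def)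
  have "B - {x. chi c x = s} = B - {x \<in> B. chi c x = s}" by auto
  then have "card (B - {x. chi c x = s}) = card B - m s"
    using fins unfolding m_def by (simp add: card_Diff_subset)
  moreover have "m s \<le> card B"
    unfolding m_def using fins by (intro card_mono) auto
  ultimately have "real (card (B - {x. chi c x = s})) = b - M"
    using s by (simp add: b_def)
  also have "\<dots> \<le> (301/100) * (k * N) + t * N"
    using b_le p M by simp
  also have "\<dots> \<le> 2 * t * N"
  proof -
    have "k * N \<le> t/100 * N"
      using k by (intro mult_right_mono) auto
    then show ?thesis using th N_pos by (simp add: algebra_simps)
  qed
  finally show ?thesis using that c s(1) by blast
qed

text \<open>The sets that are unions of cosets of the common kernel of \<open>K\<close> characters.\<close>

definition containers :: "nat \<Rightarrow> 'a set set" where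
  "containers K = (\<lambda>(L, T). {x \<in> G. map (\<lambda>c. chi c x) L \<in> T}) `
     ({L. set L \<subseteq> G \<and> length L = K} \<times> Pow {t. set t \<subseteq> {1, -1} \<and> length t = K})"

lemma containers_subset: "C \<in> containers K \<Longrightarrow> C \<subseteq> G"
  by (auto simp: containers_def)

lemma finite_containers: "finite (containers K)"
  unfolding containers_def by (intro finite_imageI finite_cartesian_product)
    (auto simp: finite_lists_length_eq finite_G)

text \<open>A container is coded by \<open>K\<close> characters and a set of the
  \<open>2 ^ K\<close> sign patterns; for fixed \<open>K\<close> this is polynomial in
  \<open>card G\<close>.\<close>

lemma card_containers: "card (containers K) \<le> card G ^ K * 2 ^ (2 ^ K)"
proof -
  have "card (containers K) \<le> card ({L. set L \<subseteq> G \<and> length L = K} \<times> Pow {t. set t \<subseteq> {1, -1::real} \<and> length t = K})"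
    unfolding containers_def by (intro card_image_le finite_cartesian_product)
      (auto simp: finite_lists_length_eq finite_G)
  also have "\<dots> = card G ^ K * 2 ^ (2 ^ K)"
    by (simp add: card_cartesian_product card_Pow card_lists_length_eq finite_lists_length_eq finite_G numeral_2_eq_2)
  finally show ?thesis .
qed

lemma fourier_diff: "fourier (\<lambda>x. f x - g x) c = fourier f c - fourier g c"
  by (simp add: fourier_def left_diff_distrib sum_subtractf)

text \<open>Averaging \<open>A\<close> over the cosets of the annihilator of its large spectrum changes its
  self-convolution little in \<open>L\<^sup>2\<close>; the container is where this average is at least \<open>\<tau>\<close>.\<close>

lemma container:
  assumes A: "A \<subseteq> G" and pos: "0 < \<tau>" "0 < \<kappa>" "0 < \<rho>"
    and K: "1 \<le> real K * (\<rho> * (\<tau>\<^sup>2 * \<kappa>)\<^sup>2)"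
  obtains C where "C \<in> containers K" "card (A - C) \<le> \<tau> * N"
    "card (popular \<kappa> C - self_sum A) \<le> \<rho> * N"
proof -
  define a :: "'a \<Rightarrow> real" where "a = indicator A"
  \<comment> \<open>Threshold for the large spectrum, chosen so that the final Chebyshev bound comes
    out as exactly \<open>\<rho> * N\<close>.\<close>
  define e where "e = \<rho> * (\<tau>\<^sup>2 * \<kappa>)\<^sup>2"
  have e: "e > 0" using pos by (simp add: e_def)
  define Spec where "Spec = {c \<in> G. (fourier a c)\<^sup>2 \<ge> e * N\<^sup>2}"
  have SpecG: "Spec \<subseteq> G" by (auto simp: Spec_def)
  note finS = finite_subset_G[OF SpecG]
  have parA: "(\<Sum>c\<in>G. (fourier a c)\<^sup>2) \<le> N\<^sup>2"
  proof -
    have "(\<Sum>x\<in>G. (a x)\<^sup>2) \<le> (\<Sum>x\<in>G. 1)"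
      by (intro sum_mono) (auto simp: a_def indicator_def)
    then have "N * (\<Sum>x\<in>G. (a x)\<^sup>2) \<le> N * N"
      by (intro mult_left_mono) auto
    then show ?thesis
      unfolding parseval by (simp add: power2_eq_square)
  qed
  \<comment> \<open>By Parseval at most \<open>1/e\<close>, hence at most \<open>K\<close>,
    coefficients are large.\<close>
  have "card Spec * (e * N\<^sup>2) \<le> (\<Sum>c\<in>Spec. (fourier a c)\<^sup>2)"
    by (rule sum_bounded_below) (auto simp: Spec_def)
  also have "\<dots> \<le> (\<Sum>c\<in>G. (fourier a c)\<^sup>2)"
    using finite_G by (intro sum_mono2) (auto simp: Spec_def)
  also have "\<dots> \<le> N\<^sup>2" by (rule parA)
  finally have "card Spec * e \<le> 1"
    using N_pos by (simp add: field_simps)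
  then have "card Spec * e \<le> K * e"
    using K by (simp add: e_def)
  then have card_Spec: "card Spec \<le> K"
    using e by simp
  define H where "H = {h \<in> G. \<forall>c\<in>Spec. chi c h = 1}"
  have H0: "0 \<in> H" and HG: "H \<subseteq> G" by (auto simp: H_def)
  then have cardH: "card H > 0"
    using finite_subset_G by (metis card_gt_0_iff empty_iff)
  have H_add: "x + y \<in> H" if "x \<in> H" "y \<in> H" for x y
    using that by (auto simp: H_def chi_add)
  have H_iff: "x + y \<in> H \<longleftrightarrow> y \<in> H" if "x \<in> H" for x y
    using that H_add by (metis add_self_left)
  \<comment> \<open>The uniform density on the annihilator \<open>H\<close>; convolving with it
    averages over cosets of \<open>H\<close>.\<close>
  define m where "m x = indicator H x / real (card H)" for x
  define f where "f = conv a m"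
  have f_nonneg: "f x \<ge> 0" for x
    by (auto simp: f_def conv_def a_def m_def intro!: sum_nonneg)
  have f_inv: "f (h + x) = f x" if "h \<in> H" for h x
    using H_iff[OF that] by (simp add: f_def conv_def m_def indicator_def add.assoc)
  define C where "C = {x \<in> G. f x \<ge> \<tau>}"
  have CG: "C \<subseteq> G" by (auto simp: C_def)
  have "C \<in> containers K"
  proof -
    obtain L0 where L0: "set L0 = Spec" "distinct L0"
      using finite_distinct_list[OF finS] by blast
    \<comment> \<open>Padding by the trivial character \<open>0\<close> gives length exactly
      \<open>K\<close> without separating further points.\<close>
    define L where "L = L0 @ replicate (K - card Spec) 0"
    have len: "length L = K"
      using L0(1) distinct_card[OF L0(2)] card_Spec by (simp add: L_def)
    have L: "set L \<subseteq> G" "Spec \<subseteq> set L"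
      using L0(1) SpecG by (auto simp: L_def split: if_splits)
    define T where "T = (\<lambda>x. map (\<lambda>c. chi c x) L) ` C"
    have "C = {x \<in> G. map (\<lambda>c. chi c x) L \<in> T}"
    proof (intro equalityI subsetI)
      fix x assume "x \<in> {x \<in> G. map (\<lambda>c. chi c x) L \<in> T}"
      then obtain y where x: "x \<in> G" and y: "y \<in> C" and "map (\<lambda>c. chi c x) L = map (\<lambda>c. chi c y) L"
        by (auto simp: T_def)
      then have "chi c x = chi c y" if "c \<in> Spec" for c
        using L that by auto
      then have "x + y \<in> H"
        using x y CG by (auto simp: H_def chi_add)
      from f_inv[OF this, of y] have "f x = f y"
        by (simp add: add.assoc)
      then show "x \<in> C" using x y by (simp add: C_def)
    qed (use CG in \<open>auto simp: T_def\<close>)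
    moreover have "T \<subseteq> {t. set t \<subseteq> {1, -1} \<and> length t = K}"
      using len by (auto simp: T_def) (use chi_values in blast)
    ultimately show ?thesis
      unfolding containers_def using L len by (intro image_eqI[where x = "(L, T)"]) auto
  qed
  moreover have "card (A - C) \<le> \<tau> * N"
  proof -
    \<comment> \<open>As \<open>f\<close> is constant on cosets of \<open>H\<close>, the whole coset
      of a point of \<open>A - C\<close> misses \<open>C\<close>. So \<open>f\<close> has total mass
      at least \<open>card (A - C)\<close> on \<open>G - C\<close>, where it is below
      \<open>\<tau>\<close>.\<close>
    have "real (card (A - C)) = (\<Sum>y\<in>A - C. 1)" by simp
    also have "\<dots> \<le> (\<Sum>y\<in>A - C. \<Sum>x\<in>G - C. m (x + y))"
    proof (rule sum_mono)
      fix y assume y: "y \<in> A - C"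
      have sub: "(+) y ` H \<subseteq> G - C"
        using y A HG f_inv by (auto simp: C_def add.commute[of y] subset_iff)
      have "1 = (\<Sum>x\<in>(+) y ` H. m (x + y))"
        using cardH by (subst sum.reindex) (auto simp: inj_on_def m_def add.commute add.left_commute)
      also have "\<dots> \<le> (\<Sum>x\<in>G - C. m (x + y))"
        using sub finite_G by (intro sum_mono2) (auto simp: m_def)
      finally show "1 \<le> (\<Sum>x\<in>G - C. m (x + y))" .
    qed
    also have "\<dots> = (\<Sum>x\<in>G - C. \<Sum>y\<in>A - C. m (x + y))"
      by (rule sum.swap)
    also have "\<dots> \<le> (\<Sum>x\<in>G - C. f x)"
    proof (rule sum_mono)
      fix x
      have "(\<Sum>y\<in>A - C. m (x + y)) = (\<Sum>y\<in>A - C. a y * m (x + y))"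
        by (intro sum.cong refl) (simp add: a_def)
      also have "\<dots> \<le> f x"
        unfolding f_def conv_def using A finite_G by (intro sum_mono2) (auto simp: m_def a_def)
      finally show "(\<Sum>y\<in>A - C. m (x + y)) \<le> f x" .
    qed
    also have "\<dots> \<le> real (card (G - C)) * \<tau>"
      by (rule sum_bounded_above) (auto simp: C_def)
    also have "\<dots> \<le> N * \<tau>"
      using pos finite_G by (intro mult_right_mono) (auto simp: card_mono)
    finally show ?thesis by (simp add: mult.commute)
  qed
  moreover have "card (popular \<kappa> C - self_sum A) \<le> \<rho> * N"
  proof -
    \<comment> \<open>Its transform is
      \<open>(fourier a c)\<^sup>2 * (1 - (fourier m c)\<^sup>2)\<close>, which vanishes on
      \<open>Spec\<close> and is below \<open>e * N\<^sup>2\<close> elsewhere on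
      \<open>G\<close>.\<close>
    define d where "d x = conv a a x - conv f f x" for x
    define X where "X = popular \<kappa> C - self_sum A"
    have XG: "X \<subseteq> G" by (auto simp: X_def popular_def)
    have mu: "\<bar>fourier m c\<bar> \<le> 1" "c \<in> Spec \<Longrightarrow> fourier m c = 1" for c
    proof -
      have *: "fourier m c = (\<Sum>h\<in>H. chi c h) / card H"
      proof -
        have "fourier m c = (\<Sum>x\<in>G. if x \<in> H then chi c x / card H else 0)"
          unfolding fourier_def m_def by (intro sum.cong refl) (simp add: indicator_def)
        also have "\<dots> = (\<Sum>x\<in>H. chi c x / card H)"
          using finite_G HG by (simp add: sum.inter_restrict[symmetric] Int_absorb1)
        finally show ?thesis by (simp add: sum_divide_distrib)
      qed
      have "\<bar>\<Sum>h\<in>H. chi c h\<bar> \<le> (\<Sum>h\<in>H. \<bar>chi c h\<bar>)" by (rule sum_abs)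
      then show "\<bar>fourier m c\<bar> \<le> 1"
        using cardH by (simp add: *)
      show "fourier m c = 1" if "c \<in> Spec"
      proof -
        have "(\<Sum>h\<in>H. chi c h) = (\<Sum>h\<in>H. 1)"
          using that by (intro sum.cong) (auto simp: H_def)
        then show ?thesis using cardH by (simp add: *)
      qed
    qed
    have Fd: "(fourier d c)\<^sup>2 \<le> e * N\<^sup>2 * (fourier a c)\<^sup>2" if "c \<in> G" for c
    proof -
      define u where "u = (fourier a c)\<^sup>2"
      define v where "v = 1 - (fourier m c)\<^sup>2"
      have u: "u \<ge> 0" by (simp add: u_def)
      have v: "0 \<le> v" "v \<le> 1"
        using mu(1)[of c] by (auto simp: v_def abs_square_le_1)
      have "fourier d c = u * v"
        unfolding d_def fourier_diff fourier_conv f_def u_def v_def by (simp add: power2_eq_square algebra_simps)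
      then have Fd: "(fourier d c)\<^sup>2 = u * (u * v\<^sup>2)"
        by (simp add: power2_eq_square)
      have "u * v\<^sup>2 \<le> e * N\<^sup>2"
      proof (cases "c \<in> Spec")
        case True
        then show ?thesis using mu(2) e by (simp add: v_def)
      next
        case False
        then have "u < e * N\<^sup>2" using that by (simp add: Spec_def u_def)
        moreover have "u * v\<^sup>2 \<le> u * 1"
          using u v by (intro mult_left_mono) (auto simp: power_le_one)
        ultimately show ?thesis by simp
      qed
      then have "u * (u * v\<^sup>2) \<le> u * (e * N\<^sup>2)"
        using u by (intro mult_left_mono)
      then show ?thesis using Fd by (simp add: u_def mult_ac)
    qed
    have "N * (\<Sum>x\<in>G. (d x)\<^sup>2) = (\<Sum>c\<in>G. (fourier d c)\<^sup>2)"
      by (simp add: parseval)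
    also have "\<dots> \<le> e * N\<^sup>2 * (\<Sum>c\<in>G. (fourier a c)\<^sup>2)"
      unfolding sum_distrib_left by (intro sum_mono Fd)
    also have "\<dots> \<le> e * N\<^sup>2 * N\<^sup>2"
      using parA e by (intro mult_left_mono) auto
    also have "\<dots> = N * (e * N * N\<^sup>2)" by (simp add: power2_eq_square mult_ac)
    finally have sum_d: "(\<Sum>x\<in>G. (d x)\<^sup>2) \<le> e * N * N\<^sup>2"
      using N_pos by (metis mult_left_le_imp_le)
    \<comment> \<open>On \<open>X\<close> the function \<open>d\<close> is large:
      \<open>conv a a x\<close> vanishes because \<open>x\<close> is not in
      \<open>self_sum A\<close>, while \<open>conv f f x\<close> is at least
      \<open>\<tau>\<^sup>2 * \<kappa> * N\<close> because \<open>x\<close> is popular in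
      \<open>C\<close>.\<close>
    have dX: "(\<tau>\<^sup>2 * \<kappa> * N)\<^sup>2 \<le> (d x)\<^sup>2" if "x \<in> X" for x
    proof -
      have "{b \<in> A. x + b \<in> A} = {}"
      proof (rule equals0I)
        fix b assume "b \<in> {b \<in> A. x + b \<in> A}"
        then have "(x + b) + b \<in> self_sum A" by (auto simp: self_sum_def)
        then show False using that by (simp add: X_def add.assoc)
      qed
      then have "conv a a x = 0"
        unfolding a_def rep_eq_conv[OF A, symmetric] rep_def by (simp only: card.empty of_nat_0)
      moreover have "\<tau>\<^sup>2 * (\<kappa> * N) \<le> conv f f x"
      proof -
        define R where "R = {b \<in> C. x + b \<in> C}"
        have "\<tau>\<^sup>2 * (\<kappa> * N) \<le> \<tau>\<^sup>2 * rep C x"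
          using that by (intro mult_left_mono) (auto simp: X_def popular_def)
        also have "\<dots> = card R * \<tau>\<^sup>2"
          by (simp add: rep_def R_def)
        also have "\<dots> \<le> (\<Sum>y\<in>R. f y * f (x + y))"
        proof (rule sum_bounded_below)
          fix y assume "y \<in> R"
          then show "\<tau>\<^sup>2 \<le> f y * f (x + y)"
            unfolding power2_eq_square using pos by (intro mult_mono) (auto simp: R_def C_def)
        qed
        also have "\<dots> \<le> conv f f x"
          unfolding conv_def using finite_G f_nonneg by (intro sum_mono2) (auto simp: R_def C_def)
        finally show ?thesis .
      qed
      ultimately have "\<tau>\<^sup>2 * \<kappa> * N \<le> - d x"
        by (simp add: d_def mult.assoc)
      then have "(\<tau>\<^sup>2 * \<kappa> * N)\<^sup>2 \<le> (- d x)\<^sup>2"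
        using pos by (intro power_mono) auto
      then show ?thesis by simp
    qed
    have "card X * (\<tau>\<^sup>2 * \<kappa> * N)\<^sup>2 \<le> (\<Sum>x\<in>X. (d x)\<^sup>2)"
      by (rule sum_bounded_below) (rule dX)
    also have "\<dots> \<le> (\<Sum>x\<in>G. (d x)\<^sup>2)"
      using finite_G XG by (intro sum_mono2) auto
    also have "\<dots> \<le> e * N * N\<^sup>2" by (rule sum_d)
    also have "\<dots> = (\<rho> * N) * (\<tau>\<^sup>2 * \<kappa> * N)\<^sup>2"
      by (simp add: e_def power_mult_distrib mult_ac)
    finally show ?thesis
      unfolding X_def[symmetric] by (rule mult_right_le_imp_le) (use pos N_pos in simp)
  qed
  ultimately show ?thesis using that by blast
qed

section \<open>Counting sumsets\<close>

definition all_sums :: "'a set set" where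
  "all_sums = self_sum ` Pow G"

definition ker :: "'a \<Rightarrow> 'a set" where
  "ker c = {x \<in> G. chi c x = 1}"

definition small :: "real \<Rightarrow> 'a set set" where
  "small e = {E. E \<subseteq> G \<and> real (card E) \<le> e * N}"

text \<open>The subsets of \<open>W\<close> whose self-sum misses \<open>v\<close>, in the form used
  by the pairing count.\<close>

definition avoiding :: "'a set \<Rightarrow> 'a \<Rightarrow> 'a set set" where
  "avoiding W v = {F. F \<subseteq> W \<and> (\<forall>x\<in>F. x + v \<notin> F)}"

lemma avoiding_self_sum:
  assumes "F \<subseteq> W" "v \<notin> self_sum F"
  shows "F \<in> avoiding W v"
proof -
  have "x + v \<notin> F" if "x \<in> F" for x
  proof
    assume "x + v \<in> F"
    then have "x + (x + v) \<in> self_sum F"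
      unfolding self_sum_def using that by blast
    then show False using assms(2) by simp
  qed
  then show ?thesis using assms(1) by (simp add: avoiding_def)
qed

lemma self_sum_subset: "A \<subseteq> G \<Longrightarrow> self_sum A \<subseteq> G"
  by (auto simp: self_sum_def subset_iff)

lemma self_sum_mono: "A \<subseteq> B \<Longrightarrow> self_sum A \<subseteq> self_sum (B :: 'a set)"
  by (auto simp: self_sum_def)

lemma ker_subset: "ker c \<subseteq> G"
  by (auto simp: ker_def)

lemma Compl_ker: "G - ker c = {x \<in> G. chi c x = -1}"
  using chi_values by (force simp: ker_def)

lemma finite_small: "finite (small e)"
  using finite_G by (simp add: small_def)

lemma finite_avoiding: "W \<subseteq> G \<Longrightarrow> finite (avoiding W v)"
  using finite_subset_G by (simp add: avoiding_def)

text \<open>Adding \<open>v \<in> ker c\<close> preserves the half-space, so the pairing bound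
  applies to its \<open>N/2\<close> points and gives \<open>3 ^ (N/4)\<close>.\<close>

lemma card_avoiding:
  assumes "c \<in> G" "c \<noteq> 0" "s = 1 \<or> s = -1" "v \<in> ker c"
  shows "card (avoiding {x \<in> G. chi c x = s} v) \<le> 2 powr (7/16 * N)"
proof -
  define W where "W = {x \<in> G. chi c x = s}"
  have W: "W \<subseteq> G" "\<And>x. x \<in> W \<Longrightarrow> x + v \<in> W"
    using assms by (auto simp: W_def ker_def chi_add)
  have cW: "real (card W) = N/2"
    using card_halfspace[OF assms(1-3)] by (simp add: W_def)
  have "(card (avoiding W v))\<^sup>2 \<le> 3 ^ card W"
    unfolding avoiding_def by (rule card_subsets_avoiding_difference) (use W finite_subset_G in auto)
  then have "(real (card (avoiding W v)))\<^sup>2 \<le> 3 ^ card W"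
    by (metis of_nat_le_iff of_nat_numeral of_nat_power)
  also have "\<dots> \<le> (2 powr (7/4)) ^ card W"
    using three_le_two_powr by (intro power_mono) auto
  also have "\<dots> = (2 powr (7/4)) powr (N/2)"
    by (simp flip: powr_realpow cW)
  also have "\<dots> = (2 powr (7/16 * N))\<^sup>2"
    by (simp add: powr_powr powr_power)
  finally show ?thesis
    unfolding W_def[symmetric] by (rule power2_le_imp_le) simp
qed

lemma card_Compl_ker: "c \<in> G \<Longrightarrow> c \<noteq> 0 \<Longrightarrow> real (card (G - ker c)) = N/2"
  using card_halfspace[of c "-1"] by (simp add: Compl_ker)

lemma two_power_card: "real (card X) = r \<Longrightarrow> 2 ^ card X = 2 powr r"
  by (metis powr_realpow zero_less_numeral)

text \<open>The product \<open>(1 - chi c x) * (1 - chi d x)\<close> is 4 on this set and 0 on the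
  rest of \<open>G\<close>; the sums of \<open>chi c\<close>, \<open>chi d\<close> and
  \<open>chi (c + d)\<close> over \<open>G\<close> all vanish.\<close>

lemma card_Compl_ker_Int:
  assumes "c \<in> G" "c \<noteq> 0" "d \<in> G" "d \<noteq> 0" "c \<noteq> d"
  shows "real (card (G - ker c - ker d)) = N/4"
proof -
  have "(\<Sum>x\<in>G. (1 - chi c x) * (1 - chi d x)) = N"
  proof -
    have "(\<Sum>x\<in>G. (1 - chi c x) * (1 - chi d x)) =
        (\<Sum>x\<in>G. 1 - chi c x - chi d x + chi (c + d) x)"
      by (simp add: chi_add_left algebra_simps)
    also have "\<dots> = N"
      using assms by (simp add: sum.distrib sum_subtractf sum_chi add_eq_0_iff_eq)
    finally show ?thesis .
  qed
  moreover have "(\<Sum>x\<in>G. (1 - chi c x) * (1 - chi d x)) = (\<Sum>x\<in>G - ker c - ker d. 4)"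
  proof (rule sum.mono_neutral_cong_right)
    fix x assume "x \<in> G - ker c - ker d"
    then have "chi c x = -1" "chi d x = -1"
      using chi_values[of c x] chi_values[of d x] by (auto simp: ker_def)
    then show "(1 - chi c x) * (1 - chi d x) = 4" by simp
  qed (use finite_G in \<open>auto simp: ker_def\<close>)
  ultimately show ?thesis by simp
qed

text \<open>For each of the \<open>N - 1\<close> hyperplanes, almost every subset \<open>T\<close>
  of the complement makes \<open>ker c \<union> T\<close> a sumset. The two subtracted terms bound
  the exceptions; the remaining choices give distinct sumsets.\<close>

lemma card_sums_lower:
  "(N - 1) * (2 powr (N/2) - N * 2 powr (7/16 * N) - N * 2 powr (N/4)) \<le> card all_sums"
proof -
  \<comment> \<open>In \<open>bad1\<close> the self-sum of \<open>T\<close> fails to fill the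
    hyperplane. In \<open>bad2\<close> the set \<open>ker c \<union> T\<close> contains a second
    hyperplane, so \<open>c\<close> could not be recovered from it.\<close>
  define bad1 where "bad1 c = (\<Union>v\<in>ker c. avoiding (G - ker c) v)" for c
  define bad2 where "bad2 c = (\<Union>d\<in>G - {0, c}. {T. T \<subseteq> G - ker c \<and> ker d \<subseteq> ker c \<union> T})" for c
  define good where "good c = Pow (G - ker c) - bad1 c - bad2 c" for c
  have finG: "finite (good c)" for c
    using finite_G by (simp add: good_def)
  have "2 powr (N/2) - N * 2 powr (7/16 * N) - N * 2 powr (N/4) \<le> card (good c)" if "c \<in> G - {0}" for c
  proof -
    have b1: "card (bad1 c) \<le> N * 2 powr (7/16 * N)"
    proof -
      have "card (bad1 c) \<le> (\<Sum>v\<in>ker c. card (avoiding (G - ker c) v))"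
        unfolding bad1_def by (rule card_UN_le) (rule finite_subset_G[OF ker_subset])
      then have "real (card (bad1 c)) \<le> (\<Sum>v\<in>ker c. real (card (avoiding (G - ker c) v)))"
        by (simp flip: of_nat_sum)
      also have "\<dots> \<le> card (ker c) * 2 powr (7/16 * N)"
        unfolding Compl_ker using that by (intro sum_bounded_above card_avoiding) auto
      also have "\<dots> \<le> N * 2 powr (7/16 * N)"
        using card_mono[OF finite_G ker_subset] by (intro mult_right_mono) auto
      finally show ?thesis .
    qed
    have b2: "card (bad2 c) \<le> N * 2 powr (N/4)"
    proof -
      have *: "card {T. T \<subseteq> G - ker c \<and> ker d \<subseteq> ker c \<union> T} \<le> 2 powr (N/4)" if d: "d \<in> G - {0, c}" for d
      proof -
        \<comment> \<open>Here \<open>T \<inter> ker d = ker d - ker c\<close> is forced, so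
          \<open>T\<close> is determined by \<open>T - ker d\<close>, a subset of a set of size
          \<open>N/4\<close>.\<close>
        have "card {T. T \<subseteq> G - ker c \<and> ker d \<subseteq> ker c \<union> T} \<le> card (Pow (G - ker c - ker d))"
        proof (rule card_inj_on_le)
          show "inj_on (\<lambda>T. T - ker d) {T. T \<subseteq> G - ker c \<and> ker d \<subseteq> ker c \<union> T}"
            by (rule inj_onI) blast
        qed (use finite_G in auto)
        also have "\<dots> = 2 ^ card (G - ker c - ker d)"
          using finite_G by (simp add: card_Pow)
        finally show ?thesis
          using two_power_card[OF card_Compl_ker_Int[of c d]] d \<open>c \<in> G - {0}\<close>
          by (metis (no_types, lifting) DiffD1 DiffD2 insertCI of_nat_le_iff of_nat_numeral of_nat_power)
      qed
      have "card (bad2 c) \<le> (\<Sum>d\<in>G - {0, c}. card {T. T \<subseteq> G - ker c \<and> ker d \<subseteq> ker c \<union> T})"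
        unfolding bad2_def using finite_G by (intro card_UN_le) auto
      then have "real (card (bad2 c)) \<le> (\<Sum>d\<in>G - {0, c}. real (card {T. T \<subseteq> G - ker c \<and> ker d \<subseteq> ker c \<union> T}))"
        by (simp flip: of_nat_sum)
      also have "\<dots> \<le> card (G - {0, c}) * 2 powr (N/4)"
        by (intro sum_bounded_above *)
      also have "\<dots> \<le> N * 2 powr (N/4)"
        using card_mono[OF finite_G, of "G - {0, c}"] by (intro mult_right_mono) auto
      finally show ?thesis .
    qed
    have "card (Pow (G - ker c)) \<le> card (good c \<union> (bad1 c \<union> bad2 c))"
      using finite_G finite_avoiding ker_subset finite_subset_G[OF ker_subset]
      by (intro card_mono) (auto simp: good_def bad1_def bad2_def)
    also have "\<dots> \<le> card (good c) + (card (bad1 c) + card (bad2 c))"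
      by (meson add_left_mono card_Un_le order_trans)
    finally have "card (Pow (G - ker c)) \<le> card (good c) + (card (bad1 c) + card (bad2 c))" .
    moreover have "real (card (Pow (G - ker c))) = 2 powr (N/2)"
      using that finite_G two_power_card[OF card_Compl_ker[of c]] by (simp add: card_Pow)
    ultimately show ?thesis using b1 b2 by linarith
  qed
  then have "card (G - {0}) * (2 powr (N/2) - N * 2 powr (7/16 * N) - N * 2 powr (N/4))
      \<le> (\<Sum>c\<in>G - {0}. real (card (good c)))"
    by (intro sum_bounded_below)
  also have "\<dots> = real (card (SIGMA c:G - {0}. good c))"
    using finite_G finG by (subst card_SigmaI) auto
  also have "\<dots> \<le> card all_sums"
  proof -
    have "card (SIGMA c:G - {0}. good c) \<le> card all_sums"
    proof (rule card_inj_on_le)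
      show "inj_on (\<lambda>(c, T). ker c \<union> T) (SIGMA c:G - {0}. good c)"
      proof (rule inj_onI)
        fix p r
        assume "p \<in> (SIGMA c:G - {0}. good c)" "r \<in> (SIGMA c:G - {0}. good c)"
          and eq: "(case p of (c, T) \<Rightarrow> ker c \<union> T) = (case r of (c, T) \<Rightarrow> ker c \<union> T)"
        then obtain c T d U where pr: "p = (c, T)" "r = (d, U)"
          and *: "c \<in> G" "c \<noteq> 0" "T \<in> good c" "d \<in> G" "d \<noteq> 0" "U \<in> good d" "ker c \<union> T = ker d \<union> U"
          by auto
        have "c = d"
        proof (rule ccontr)
          assume "c \<noteq> d"
          then have "T \<in> bad2 c"
            using * by (auto simp: bad2_def good_def)
          then show False using * by (simp add: good_def)
        qed
        moreover from this have "T = U"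
          using * by (auto simp: good_def)
        ultimately show "p = r" by (simp add: pr)
      qed
      show "(\<lambda>(c, T). ker c \<union> T) ` (SIGMA c:G - {0}. good c) \<subseteq> all_sums"
      proof (rule image_subsetI)
        fix p assume "p \<in> (SIGMA c:G - {0}. good c)"
        then obtain c T where p: "p = (c, T)" and c: "c \<in> G" "c \<noteq> 0" and T: "T \<in> good c"
          by auto
        have TD: "T \<subseteq> G - ker c" using T by (simp add: good_def)
        have "ker c \<subseteq> self_sum T"
        proof (rule ccontr)
          assume "\<not> ?thesis"
          then obtain v where "v \<in> ker c" "v \<notin> self_sum T" by blast
          then have "T \<in> bad1 c"
            using avoiding_self_sum[OF TD] by (auto simp: bad1_def)
          then show False using T by (simp add: good_def)
        qed
        moreover have "self_sum T \<subseteq> ker c"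
          using TD unfolding Compl_ker by (auto simp: self_sum_def ker_def chi_add subset_iff)
        ultimately have TT: "self_sum T = ker c" by blast
        obtain x where x: "x \<in> G"
          using zero_G by blast
        \<comment> \<open>A translate of \<open>{0} \<union> T\<close>; the shift cancels in sums,
          leaving \<open>0\<close>, \<open>T\<close> and \<open>self_sum T\<close>.\<close>
        define A where "A = insert x ((+) x ` T)"
        have "self_sum A = insert 0 (T \<union> self_sum T)"
        proof
          show "self_sum A \<subseteq> insert 0 (T \<union> self_sum T)"
            unfolding A_def self_sum_def by (auto simp: add_ac) blast
          show "insert 0 (T \<union> self_sum T) \<subseteq> self_sum A"
          proof -
            have sum_mem: "a + b \<in> self_sum A" if "a \<in> A" "b \<in> A" for a b
              using that by (auto simp: self_sum_def)
            have "0 \<in> self_sum A"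
              using sum_mem[of x x] by (simp add: A_def)
            moreover have "y \<in> self_sum A" if "y \<in> T" for y
              using sum_mem[of x "x + y"] that by (simp add: A_def)
            moreover have "y + z \<in> self_sum A" if "y \<in> T" "z \<in> T" for y z
              using sum_mem[of "x + y" "x + z"] that by (simp add: A_def add_ac)
            ultimately show ?thesis unfolding self_sum_def[of T] by blast
          qed
        qed
        also have "\<dots> = ker c \<union> T"
          unfolding TT by (auto simp: ker_def)
        finally have "ker c \<union> T = self_sum A" ..
        moreover have "A \<subseteq> G"
          using x TD by (auto simp: A_def)
        ultimately show "(case p of (c, T) \<Rightarrow> ker c \<union> T) \<in> all_sums"
          by (auto simp: all_sums_def p)
      qed
      show "finite all_sums" using finite_G by (simp add: all_sums_def)
    qed
    then show ?thesis by simp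
  qed
  finally show ?thesis
    using finite_G N_pos by (simp add: card_Diff_subset of_nat_diff Suc_leI)
qed

text \<open>Four families cover all sumsets: \<open>F4\<close> gives the main term,
  \<open>F1\<close> and \<open>F2\<close> the container term, \<open>F3\<close> the last one. The
  bounds on \<open>small\<close> are hypotheses so that the parameters can be fixed
  afterwards.\<close>

lemma card_sums_upper:
  assumes t: "0 < t" "t \<le> 1/10" and pos: "0 < \<tau>" "0 < \<rho>"
    and K: "1 \<le> real K * (\<rho> * (\<tau>\<^sup>2 * (t\<^sup>2/10))\<^sup>2)"
    and small_\<rho>: "card (small \<rho>) \<le> 2 powr (t\<^sup>2/20 * N)"
    and small_\<tau>: "card (small \<tau>) \<le> 2 powr (t\<^sup>2/20 * N)"
    and small_t: "card (small (2 * t + \<tau>)) \<le> 2 powr (1/32 * N)"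
  shows "card all_sums \<le> (N - 1) * 2 powr (N/2)
    + 2 * (N ^ K * 2 ^ (2 ^ K) * 2 powr ((1/2 - t\<^sup>2/20) * N)) + 2 * N\<^sup>2 * 2 powr (15/32 * N)"
proof -
  define k where "k = t\<^sup>2/10"
  have k: "k > 0" "t\<^sup>2/20 = k/2" using t by (auto simp: k_def)
  define c0 where "c0 = N ^ K * 2 ^ (2 ^ K) * 2 powr ((1/2 - k/2) * N)"
  \<comment> \<open>For \<open>C\<close> with many popular sums: the sumset is encoded by the few
    popular sums it misses and by its part outside them.\<close>
  define F1 where "F1 = (\<lambda>(C, E, T). (popular k C - E) \<union> T) `
    (SIGMA C:{C \<in> containers K. (1/2 + k) * N \<le> card (popular k C)}. small \<rho> \<times> Pow (G - popular k C))"
  \<comment> \<open>For small \<open>C\<close>: the summand \<open>A\<close> is encoded by its part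
    in \<open>C\<close> and the few remaining points.\<close>
  define F2 where "F2 = (\<lambda>(C, E, T). self_sum (T \<union> E)) `
    (SIGMA C:{C \<in> containers K. card C \<le> (1/2 - k) * N}. small \<tau> \<times> Pow C)"
  \<comment> \<open>For \<open>A\<close> almost inside the half-space given by \<open>c\<close> and
    \<open>s\<close>, with a sumset missing some \<open>v\<close> in the hyperplane.\<close>
  define X3 where "X3 = {(c, s, v). c \<in> G - {0} \<and> s \<in> {1, -1::real} \<and> v \<in> ker c}"
  define F3 where "F3 = (\<lambda>(p, F, E). self_sum (F \<union> E)) `
    (SIGMA p:X3. case p of (c, s, v) \<Rightarrow> avoiding {x \<in> G. chi c x = s} v \<times> small (2 * t + \<tau>))"
  define F4 where "F4 = (\<lambda>(c, T). ker c \<union> T) ` (SIGMA c:G - {0}. Pow (G - ker c))"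
  have popG: "popular k C \<subseteq> G" for C by (auto simp: popular_def)
  \<comment> \<open>Half of the gain \<open>k\<close> is spent on the choice of the small
    exceptional set.\<close>
  have powr_half: "2 powr (k/2 * N) * 2 powr ((1/2 - k) * N) = 2 powr ((1/2 - k/2) * N)"
    by (simp add: powr_add[symmetric] algebra_simps)
  have cont: "card X * 2 powr ((1/2 - k/2) * N) \<le> c0" if "X \<subseteq> containers K" for X
  proof -
    have "card X \<le> card G ^ K * 2 ^ (2 ^ K)"
      using card_mono[OF finite_containers that] card_containers by (rule order_trans)
    then have "real (card X) \<le> real (card G ^ K * 2 ^ (2 ^ K))"
      by (rule of_nat_mono)
    then show ?thesis
      unfolding c0_def by (intro mult_right_mono) simp_all
  qed
  have c1: "card F1 \<le> c0"
  proof -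
    have "card F1 \<le> card {C \<in> containers K. (1/2 + k) * N \<le> card (popular k C)} * 2 powr ((1/2 - k/2) * N)"
      unfolding F1_def
    proof (rule card_image_Sigma_le)
      fix C assume C: "C \<in> {C \<in> containers K. (1/2 + k) * N \<le> card (popular k C)}"
      have "card (G - popular k C) = N - card (popular k C)"
        using card_Diff_subset[OF finite_subset_G[OF popG] popG] card_mono[OF finite_G popG] by simp
      then have "card (G - popular k C) \<le> (1/2 - k) * N"
        using C by (simp add: algebra_simps)
      then have "2 ^ card (G - popular k C) \<le> 2 powr ((1/2 - k) * N)"
        by (simp add: two_power_card[OF refl])
      then have "real (card (small \<rho>)) * 2 ^ card (G - popular k C) \<le> 2 powr (k/2 * N) * 2 powr ((1/2 - k) * N)"
        using small_\<rho> k by (intro mult_mono) auto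
      then show "card (small \<rho> \<times> Pow (G - popular k C)) \<le> 2 powr ((1/2 - k/2) * N)"
        using finite_G unfolding powr_half by (simp add: card_cartesian_product card_Pow)
    qed (use finite_containers finite_small finite_G in auto)
    also have "\<dots> \<le> c0" by (rule cont) auto
    finally show ?thesis .
  qed
  have c2: "card F2 \<le> c0"
  proof -
    have "card F2 \<le> card {C \<in> containers K. card C \<le> (1/2 - k) * N} * 2 powr ((1/2 - k/2) * N)"
      unfolding F2_def
    proof (rule card_image_Sigma_le)
      fix C assume C: "C \<in> {C \<in> containers K. card C \<le> (1/2 - k) * N}"
      then have "2 ^ card C \<le> 2 powr ((1/2 - k) * N)"
        by (simp add: two_power_card[OF refl])
      then have "real (card (small \<tau>)) * 2 ^ card C \<le> 2 powr (k/2 * N) * 2 powr ((1/2 - k) * N)"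
        using small_\<tau> k by (intro mult_mono) auto
      then show "card (small \<tau> \<times> Pow C) \<le> 2 powr ((1/2 - k/2) * N)"
        using finite_subset_G[OF containers_subset, of C K] C unfolding powr_half
        by (simp add: card_cartesian_product card_Pow)
    qed (use finite_containers finite_small containers_subset finite_subset_G in auto)
    also have "\<dots> \<le> c0" by (rule cont) auto
    finally show ?thesis .
  qed
  have X3: "X3 \<subseteq> G \<times> {1, -1} \<times> G"
    using ker_subset by (auto simp: X3_def)
  have finX3: "finite X3"
    by (rule finite_subset[OF X3]) (use finite_G in simp)
  have c3: "card F3 \<le> 2 * N\<^sup>2 * 2 powr (15/32 * N)"
  proof -
    have "card X3 \<le> card (G \<times> {1, -1::real} \<times> G)"
      using X3 finite_G by (intro card_mono) auto
    also have "\<dots> = 2 * (card G)\<^sup>2"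
      by (simp add: card_cartesian_product power2_eq_square)
    finally have "real (card X3) \<le> real (2 * (card G)\<^sup>2)"
      by (rule of_nat_mono)
    then have cX3: "card X3 \<le> 2 * N\<^sup>2"
      by simp
    have "card F3 \<le> card X3 * 2 powr (15/32 * N)"
      unfolding F3_def
    proof (rule card_image_Sigma_le)
      fix p assume "p \<in> X3"
      then obtain c s v where p: "p = (c, s, v)" and c: "c \<in> G" "c \<noteq> 0" "s = 1 \<or> s = -1" "v \<in> ker c"
        by (auto simp: X3_def)
      \<comment> \<open>The exponents add to \<open>7/16 + 1/32 = 15/32\<close>, still below
        \<open>1/2\<close>.\<close>
      have "real (card (avoiding {x \<in> G. chi c x = s} v)) * real (card (small (2 * t + \<tau>)))
          \<le> 2 powr (7/16 * N) * 2 powr (1/32 * N)"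
        using card_avoiding[OF c] small_t by (intro mult_mono) auto
      also have "\<dots> = 2 powr (15/32 * N)"
        by (simp add: powr_add[symmetric])
      finally show "card (case p of (c, s, v) \<Rightarrow> avoiding {x \<in> G. chi c x = s} v \<times> small (2 * t + \<tau>))
          \<le> 2 powr (15/32 * N)"
        by (simp add: p card_cartesian_product)
    qed (use finX3 finite_small finite_avoiding in \<open>auto split: prod.split\<close>)
    also have "\<dots> \<le> 2 * N\<^sup>2 * 2 powr (15/32 * N)"
      using cX3 by (intro mult_right_mono) auto
    finally show ?thesis .
  qed
  have c4: "card F4 \<le> (N - 1) * 2 powr (N/2)"
  proof -
    have "card F4 \<le> card (G - {0}) * 2 powr (N/2)"
      unfolding F4_def
      by (rule card_image_Sigma_le)
        (use finite_G two_power_card[OF card_Compl_ker] in \<open>auto simp: card_Pow\<close>)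
    then show ?thesis
      using finite_G N_pos by (simp add: card_Diff_subset of_nat_diff Suc_leI)
  qed
  have "all_sums \<subseteq> F1 \<union> F2 \<union> F3 \<union> F4"
  proof
    fix S assume "S \<in> all_sums"
    then obtain A where A: "A \<subseteq> G" and S: "S = self_sum A"
      by (auto simp: all_sums_def)
    have SG: "S \<subseteq> G" using A S self_sum_subset by simp
    obtain C where C: "C \<in> containers K" "card (A - C) \<le> \<tau> * N" "card (popular k C - S) \<le> \<rho> * N"
      using container[OF A pos(1) k(1) pos(2)] K unfolding k_def S by blast
    have CG: "C \<subseteq> G" using containers_subset C by blast
    consider (pop) "(1/2 + k) * N \<le> card (popular k C)" | (little) "card C \<le> (1/2 - k) * N"
      | (hyper) "card (popular k C) < (1/2 + k) * N" "(1/2 - k) * N < card C"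
      by linarith
    then show "S \<in> F1 \<union> F2 \<union> F3 \<union> F4"
    proof cases
      case pop
      have "S = (popular k C - (popular k C - S)) \<union> (S - popular k C)" by auto
      moreover have "popular k C - S \<in> small \<rho>"
        using C popG by (auto simp: small_def)
      ultimately have "S \<in> F1"
        unfolding F1_def using C pop SG
        by (intro image_eqI[where x = "(C, popular k C - S, S - popular k C)"]) auto
      then show ?thesis by simp
    next
      case little
      have "A - C \<in> small \<tau>"
        using C A by (auto simp: small_def)
      moreover have "S = self_sum (A \<inter> C \<union> (A - C))"
        using S by (simp add: Un_Diff_Int Int_Diff_Un)
      ultimately have "S \<in> F2"
        unfolding F2_def using C little
        by (intro image_eqI[where x = "(C, A - C, A \<inter> C)"]) auto
      then show ?thesis by simp
    next
      case hyper
      obtain c s where c: "c \<in> G" "c \<noteq> 0" "s = 1 \<or> s = -1"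
        and near: "card (C - {x. chi c x = s}) \<le> 2 * t * N"
        using near_hyperplane[OF CG t] hyper unfolding k_def by blast
      define W where "W = {x \<in> G. chi c x = s}"
      show ?thesis
      proof (cases "ker c \<subseteq> S")
        case True
        then have "S = ker c \<union> (S - ker c)" by auto
        then have "S \<in> F4"
          unfolding F4_def using c SG by (intro image_eqI[where x = "(c, S - ker c)"]) auto
        then show ?thesis by simp
      next
        case False
        then obtain v where v: "v \<in> ker c" "v \<notin> S" by blast
        then have "v \<notin> self_sum (A \<inter> W)"
          using S self_sum_mono[of "A \<inter> W" A] by auto
        then have av: "A \<inter> W \<in> avoiding W v"
          by (intro avoiding_self_sum) auto
        have "card (A - W) \<le> card ((A - C) \<union> (C - {x. chi c x = s}))"
          using A CG finite_subset_G by (intro card_mono) (auto simp: W_def)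
        also have "\<dots> \<le> card (A - C) + card (C - {x. chi c x = s})"
          by (rule card_Un_le)
        finally have "card (A - W) \<le> (2 * t + \<tau>) * N"
          using near C(2) by (simp add: algebra_simps)
        then have sm: "A - W \<in> small (2 * t + \<tau>)"
          using A by (auto simp: small_def)
        have "S = self_sum (A \<inter> W \<union> (A - W))"
          using S by (simp add: Un_Diff_Int Int_Diff_Un)
        then have "S \<in> F3"
          unfolding F3_def using c v av sm
          by (intro image_eqI[where x = "((c, s, v), A \<inter> W, A - W)"]) (auto simp: X3_def W_def)
        then show ?thesis by simp
      qed
    qed
  qed
  moreover have "finite (F1 \<union> F2 \<union> F3 \<union> F4)"
  proof -
    have "finite F1" "finite F2" "finite F4"
      unfolding F1_def F2_def F4_def
      using finite_containers finite_small finite_G containers_subset finite_subset_G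
      by (auto intro!: finite_imageI finite_SigmaI)
    moreover have "finite F3"
      unfolding F3_def using finX3 finite_small finite_avoiding
      by (auto intro!: finite_imageI finite_SigmaI)
    ultimately show ?thesis by simp
  qed
  ultimately have "card all_sums \<le> card (F1 \<union> F2 \<union> F3 \<union> F4)"
    by (rule card_mono[rotated])
  also have "\<dots> \<le> card F1 + card F2 + card F3 + card F4"
    using card_Un_le[of "F1 \<union> F2 \<union> F3" F4] card_Un_le[of "F1 \<union> F2" F3] card_Un_le[of F1 F2] by linarith
  finally have "real (card all_sums) \<le> real (card F1) + real (card F2) + real (card F3) + real (card F4)"
    by linarith
  then show ?thesis
    using c1 c2 c3 c4 unfolding k(2) c0_def[symmetric] by linarith
qed

end

section \<open>The space of bit vectors\<close>

text \<open>Vectors are extended by zero to all of \<open>nat\<close>, so that they live in a type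
  that is a group under pointwise addition.\<close>

definition F2 :: "nat \<Rightarrow> (nat \<Rightarrow> bit) set" where
  "F2 n = {f. \<forall>i\<ge>n. f i = 0}"

text \<open>The standard character \<open>(-1)^(c . x)\<close>.\<close>

definition F2_char :: "nat \<Rightarrow> (nat \<Rightarrow> bit) \<Rightarrow> (nat \<Rightarrow> bit) \<Rightarrow> real" where
  "F2_char n c x = (if (\<Sum>i<n. c i * x i) = 0 then 1 else -1)"

definition coords :: "bit vec \<Rightarrow> nat \<Rightarrow> bit" where
  "coords v i = (if i < dim_vec v then v $ i else 0)"

lemma F2_eq_image: "F2 n = (\<lambda>A i. of_bool (i \<in> A)) ` Pow {..<n}"
proof (intro equalityI subsetI)
  fix f :: "nat \<Rightarrow> bit" assume f: "f \<in> F2 n"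
  have "f = (\<lambda>i. of_bool (i \<in> {i. f i \<noteq> 0}))"
    by (rule ext) auto
  moreover have "{i. f i \<noteq> 0} \<subseteq> {..<n}"
    using f by (auto simp: F2_def not_le[symmetric])
  ultimately show "f \<in> (\<lambda>A i. of_bool (i \<in> A)) ` Pow {..<n}"
    by (intro image_eqI) auto
qed (auto simp: F2_def)

lemma finite_F2: "finite (F2 n)"
  by (simp add: F2_eq_image)

lemma card_F2: "card (F2 n) = 2 ^ n"
proof -
  have "inj_on (\<lambda>A i. of_bool (i \<in> A) :: bit) (Pow {..<n})"
    by (rule inj_onI) (auto simp: fun_eq_iff of_bool_eq_iff)
  then show ?thesis
    by (simp add: F2_eq_image card_image card_Pow)
qed

interpretation F2: elementary_2_group "F2 n" "F2_char n" for n
proof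
  show "finite (F2 n)" by (rule finite_F2)
  show "0 \<in> F2 n" by (simp add: F2_def)
  show "x + y \<in> F2 n" if "x \<in> F2 n" "y \<in> F2 n" for x y
    using that by (simp add: F2_def)
  show "x + x = 0" for x :: "nat \<Rightarrow> bit"
    by (rule ext) simp
  show "F2_char n c x = 1 \<or> F2_char n c x = -1" for c x
    by (simp add: F2_char_def)
  have sgn_add: "(if a + b = 0 then 1 else -1) =
      (if a = 0 then 1 else -1) * (if b = 0 then 1 else -1 :: real)" for a b :: bit
    by (cases a; cases b) auto
  show "F2_char n c (x + y) = F2_char n c x * F2_char n c y" for c x y
    unfolding F2_char_def sgn_add[symmetric] by (simp only: plus_fun_def distrib_left sum.distrib)
  show "F2_char n c x = F2_char n x c" for c x
    unfolding F2_char_def by (simp only: mult.commute)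
  show "\<exists>x\<in>F2 n. F2_char n c x = -1" if c: "c \<in> F2 n" "c \<noteq> 0" for c
  proof -
    obtain i where i: "c i \<noteq> 0" using c(2) by (auto simp: fun_eq_iff)
    then have "i < n" using c(1) by (auto simp: F2_def not_le[symmetric])
    define x :: "nat \<Rightarrow> bit" where "x j = (if j = i then 1 else 0)" for j
    have "(\<Sum>j<n. c j * x j) = (\<Sum>j<n. if j = i then c j else 0)"
      by (intro sum.cong refl) (simp add: x_def)
    also have "\<dots> = c i" using \<open>i < n\<close> by simp
    finally have "F2_char n c x = -1" using i by (simp add: F2_char_def)
    moreover have "x \<in> F2 n" using \<open>i < n\<close> by (simp add: F2_def x_def)
    ultimately show ?thesis by blast
  qed
qed

lemma bij_coords: "bij_betw coords (carrier_vec n) (F2 n)"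
  by (rule bij_betwI[where g = "vec n"]) (auto simp: coords_def F2_def fun_eq_iff)

text \<open>The bijection \<open>coords\<close> is additive on \<open>carrier_vec n\<close>, hence
  carries sumsets to self-sums injectively.\<close>

lemma card_sumsets_eq: "card (sumsets n) = card (F2.all_sums n)"
proof -
  have add: "coords (v + w) = coords v + coords w" if "v \<in> carrier_vec n" "w \<in> carrier_vec n" for v w
    using that by (auto simp: coords_def fun_eq_iff)
  have image: "coords ` sumset A = self_sum (coords ` A)" if "A \<subseteq> carrier_vec n" for A
  proof (intro equalityI subsetI)
    fix x assume "x \<in> coords ` sumset A"
    then obtain v w where "v \<in> A" "w \<in> A" "x = coords (v + w)"
      by (auto simp: sumset_def)
    then show "x \<in> self_sum (coords ` A)"
      using add[of v w] that by (auto simp: self_sum_def)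
  next
    fix x assume "x \<in> self_sum (coords ` A)"
    then obtain v w where "v \<in> A" "w \<in> A" "x = coords v + coords w"
      by (auto simp: self_sum_def)
    then have "x = coords (v + w)" "v + w \<in> sumset A"
      using add[of v w] that by (auto simp: sumset_def subset_iff)
    then show "x \<in> coords ` sumset A" by blast
  qed
  have img: "coords ` carrier_vec n = F2 n" and inj: "inj_on coords (carrier_vec n)"
    using bij_coords by (auto simp: bij_betw_def)
  have "F2.all_sums n = self_sum ` (`) coords ` Pow (carrier_vec n)"
    by (simp add: F2.all_sums_def image_Pow_surj[OF img])
  also have "\<dots> = (`) coords ` sumset ` Pow (carrier_vec n)"
    unfolding image_image by (intro image_cong refl) (simp add: image)
  also have "sumset ` Pow (carrier_vec n) = sumsets n"
    by (auto simp: sumsets_def)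
  finally have eq: "F2.all_sums n = (`) coords ` sumsets n" .
  have "sumsets n \<subseteq> Pow (carrier_vec n)"
    by (auto simp: sumsets_def sumset_def subset_iff)
  then have "inj_on ((`) coords) (sumsets n)"
    using inj_on_image_Pow[OF inj] inj_on_subset by blast
  then show ?thesis
    by (simp add: eq card_image)
qed

section \<open>Passage to the limit\<close>

lemma power_times_exp_decay:
  fixes d :: real
  assumes "d > 0"
  shows "(\<lambda>n::nat. (2 ^ n) ^ K * 2 powr (-(d * 2 ^ n))) \<longlonglongrightarrow> 0"
proof -
  \<comment> \<open>Now \<open>exp (a * 2 ^ n) = 2 powr (d * 2 ^ n)\<close>, so up to the constant
    \<open>a ^ K\<close> the claim is that \<open>x ^ K / exp x\<close> tends to 0, along
    \<open>x = a * 2 ^ n\<close>.\<close>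
  define a where "a = d * ln 2"
  have a: "a > 0" using assms by (simp add: a_def)
  have "filterlim (\<lambda>n::nat. 2 ^ n :: real) at_top sequentially"
    by (rule filterlim_at_top_mono[OF filterlim_real_sequentially])
      (simp add: of_nat_less_two_power less_imp_le)
  then have "filterlim (\<lambda>n::nat. a * 2 ^ n) at_top sequentially"
    by (rule filterlim_tendsto_pos_mult_at_top[OF tendsto_const a])
  from filterlim_compose[OF tendsto_power_div_exp_0 this]
  have "(\<lambda>n. (1 / a ^ K) * ((a * 2 ^ n) ^ K / exp (a * 2 ^ n))) \<longlonglongrightarrow> (1 / a ^ K) * 0"
    by (intro tendsto_mult_left)
  moreover have "(1 / a ^ K) * ((a * 2 ^ n) ^ K / exp (a * 2 ^ n)) = (2 ^ n) ^ K * 2 powr (-(d * 2 ^ n))" for n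
    using assms by (simp add: power_mult_distrib powr_def a_def exp_minus field_simps)
  ultimately show ?thesis by simp
qed

theorem theorem1p1:
  "(\<lambda>n::nat. real (card (sumsets n)) / ((2 ^ n - 1) * 2 ^ (2 ^ (n - 1)))) \<longlonglongrightarrow> 1"
proof -
  obtain e :: real where e: "e > 0"
    "\<forall>X :: (nat \<Rightarrow> bit) set. finite X \<longrightarrow> real (card {E. E \<subseteq> X \<and> real (card E) \<le> e * real (card X)}) \<le> 2 powr (1/32 * real (card X))"
    using card_small_subsets_le[of "1/32", where 'a = "nat \<Rightarrow> bit"] by auto
  \<comment> \<open>The parameters are fixed in the order \<open>e\<close>, \<open>t\<close>,
    \<open>\<rho>\<close>, \<open>\<tau>\<close>, \<open>K\<close>; the bounds
    \<open>t \<le> e/4\<close> and \<open>\<tau> \<le> e/2\<close> give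
    \<open>2 * t + \<tau> \<le> e\<close>.\<close>
  define t where "t = min (1/10) (e/4)"
  have t: "0 < t" "t \<le> 1/10" "t \<le> e/4" using e by (auto simp: t_def)
  obtain \<rho> :: real where \<rho>: "\<rho> > 0"
    "\<forall>X :: (nat \<Rightarrow> bit) set. finite X \<longrightarrow> real (card {E. E \<subseteq> X \<and> real (card E) \<le> \<rho> * real (card X)}) \<le> 2 powr (t\<^sup>2/20 * real (card X))"
    using card_small_subsets_le[of "t\<^sup>2/20", where 'a = "nat \<Rightarrow> bit"] t by auto
  define \<tau> where "\<tau> = min \<rho> (e/2)"
  have \<tau>: "0 < \<tau>" "\<tau> \<le> \<rho>" "\<tau> \<le> e/2" using \<rho> e by (auto simp: \<tau>_def)
  have "\<rho> * (\<tau>\<^sup>2 * (t\<^sup>2/10))\<^sup>2 > 0" using \<rho> \<tau> t by simp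
  then obtain K where K: "1 \<le> real K * (\<rho> * (\<tau>\<^sup>2 * (t\<^sup>2/10))\<^sup>2)"
    using ex_less_of_nat_mult less_imp_le by blast
  have small_mono: "card (F2.small n a) \<le> card (F2.small n b)" if "a \<le> b" for n and a b :: real
  proof (rule card_mono[OF F2.finite_small])
    show "F2.small n a \<subseteq> F2.small n b"
      using that by (auto simp: F2.small_def card_F2 intro: order_trans mult_right_mono)
  qed
  have small_\<rho>: "card (F2.small n \<rho>) \<le> 2 powr (t\<^sup>2/20 * card (F2 n))" for n
    unfolding F2.small_def by (rule \<rho>(2)[rule_format, OF finite_F2])
  have small_\<tau>: "card (F2.small n \<tau>) \<le> 2 powr (t\<^sup>2/20 * card (F2 n))" for n
    using small_\<rho>[of n] small_mono[OF \<tau>(2), of n] by linarith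
  have small_t: "card (F2.small n (2 * t + \<tau>)) \<le> 2 powr (1/32 * card (F2 n))" for n
  proof -
    have "card (F2.small n e) \<le> 2 powr (1/32 * card (F2 n))"
      unfolding F2.small_def by (rule e(2)[rule_format, OF finite_F2])
    moreover have "2 * t + \<tau> \<le> e" using t \<tau> by linarith
    ultimately show ?thesis using small_mono[of "2 * t + \<tau>" e n] by linarith
  qed
  define M :: "nat \<Rightarrow> real" where "M n = 2 ^ n" for n
  define D where "D n = (M n - 1) * 2 powr (M n/2)" for n
  \<comment> \<open>The decay rates are the gaps below \<open>1/2\<close>:
    \<open>1/16 = 1/2 - 7/16\<close>, \<open>1/4 = 1/2 - 1/4\<close>, and in \<open>upp\<close> also
    \<open>1/32 = 1/2 - 15/32\<close>. The power 1 is written out to match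
    \<open>power_times_exp_decay\<close>.\<close>
  define low where "low = (\<lambda>n. 1 - M n ^ 1 * 2 powr (-(1/16 * M n)) - M n ^ 1 * 2 powr (-(1/4 * M n)))"
  define upp where "upp = (\<lambda>n. 1 + 2 * 2 ^ (2 ^ K) * (M n ^ K * 2 powr (-(t\<^sup>2/20 * M n)))
    + 2 * (M n ^ 2 * 2 powr (-(1/32 * M n))))"
  have split: "2 powr (M n/2) * 2 powr (-x) = 2 powr (M n/2 - x)" for n x
    by (simp add: powr_add[symmetric])
  have bounds: "low n \<le> real (card (sumsets n)) / D n \<and> real (card (sumsets n)) / D n \<le> upp n"
    if "n \<ge> 1" for n
  proof -
    have M: "M n \<ge> 2" using power_increasing[OF that, of "2::real"] by (simp add: M_def)
    have card: "real (card (F2 n)) = M n" by (simp add: card_F2 M_def)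
    have D: "D n > 0" using M by (simp add: D_def)
    have "low n * D n = (M n - 1) * (2 powr (M n/2) - M n * (2 powr (M n/2) * 2 powr (-(1/16 * M n)))
        - M n * (2 powr (M n/2) * 2 powr (-(1/4 * M n))))"
      by (simp add: low_def D_def algebra_simps)
    also have "\<dots> = (M n - 1) * (2 powr (M n/2) - M n * 2 powr (7/16 * M n) - M n * 2 powr (M n/4))"
      unfolding split by simp
    also have "\<dots> \<le> card (sumsets n)"
      using F2.card_sums_lower[of n] unfolding card card_sumsets_eq .
    finally have lower: "low n * D n \<le> card (sumsets n)" .
    have "card (sumsets n) \<le> D n + 2 * (M n ^ K * 2 ^ (2 ^ K) * 2 powr ((1/2 - t\<^sup>2/20) * M n))
        + 2 * (M n)\<^sup>2 * 2 powr (15/32 * M n)"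
      using F2.card_sums_upper[OF t(1,2) \<tau>(1) \<rho>(1) K small_\<rho> small_\<tau> small_t, of n]
      unfolding card card_sumsets_eq D_def .
    \<comment> \<open>The factor 1 is a placeholder, next enlarged to \<open>M n - 1\<close> so that
      \<open>D n\<close> factors out.\<close>
    also have "\<dots> = D n + 1 * (2 powr (M n/2) * (upp n - 1))"
    proof -
      have "2 powr ((1/2 - t\<^sup>2/20) * M n) = 2 powr (M n/2) * 2 powr (-(t\<^sup>2/20 * M n))"
        unfolding split by (simp add: algebra_simps)
      moreover have "2 powr (15/32 * M n) = 2 powr (M n/2) * 2 powr (-(1/32 * M n))"
        unfolding split by simp
      ultimately show ?thesis
        unfolding upp_def by (simp add: algebra_simps)
    qed
    also have "\<dots> \<le> D n + (M n - 1) * (2 powr (M n/2) * (upp n - 1))"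
      using M by (intro add_left_mono mult_right_mono) (auto simp: upp_def)
    also have "\<dots> = upp n * D n"
      by (simp add: D_def algebra_simps)
    finally have "card (sumsets n) \<le> upp n * D n" .
    with lower D show ?thesis
      by (simp add: pos_le_divide_eq pos_divide_le_eq)
  qed
  have "low \<longlonglongrightarrow> 1 - 0 - 0"
    unfolding low_def M_def by (intro tendsto_diff tendsto_const power_times_exp_decay) auto
  then have low: "low \<longlonglongrightarrow> 1" by simp
  have "upp \<longlonglongrightarrow> 1 + 2 * 2 ^ (2 ^ K) * 0 + 2 * 0"
    unfolding upp_def M_def using t(1)
    by (intro tendsto_add tendsto_mult_left tendsto_const power_times_exp_decay) auto
  then have upp: "upp \<longlonglongrightarrow> 1" by simp
  have "(\<lambda>n. real (card (sumsets n)) / D n) \<longlonglongrightarrow> 1"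
    by (rule tendsto_sandwich[OF _ _ low upp]; rule eventually_sequentiallyI[of 1]; use bounds in blast)
  moreover have "\<forall>\<^sub>F n in sequentially. real (card (sumsets n)) / D n =
      real (card (sumsets n)) / ((2 ^ n - 1) * 2 ^ (2 ^ (n - 1)))"
  \<comment> \<open>Subtraction on \<open>nat\<close> is truncated, so \<open>2 ^ (n - 1)\<close>
    equals \<open>M n / 2\<close> only from \<open>n = 1\<close> on.\<close>
  proof (rule eventually_sequentiallyI[of 1])
    fix n :: nat assume "n \<ge> 1"
    then have "M n/2 = real (2 ^ (n - 1))"
      by (cases n) (auto simp: M_def)
    then have "2 powr (M n/2) = 2 ^ (2 ^ (n - 1))"
      by (metis powr_realpow zero_less_numeral)
    then show "real (card (sumsets n)) / D n = real (card (sumsets n)) / ((2 ^ n - 1) * 2 ^ (2 ^ (n - 1)))"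
      by (simp add: D_def M_def)
  qed
  ultimately show ?thesis
    by (rule Lim_transform_eventually)
qed

end
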